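(* For a graph $G$ with $m$ edges, in $O(m^2)$ time one can find a homogeneous pair of cliques in $G$ or determine that none exists.
   Context: A homogeneous pair of cliques in $G$ is a pair $(A,B)$ of disjoint nonempty cliques with $|A\cup B|\ge3$ such that every vertex outside $A\cup B$ is adjacent to all or none of $A$ and to all or none of $B$. *)

theory Defs
  imports Complex_Main "HOL-Library.Landau_Symbols"
begin

section \<open>Graphs and homogeneous pairs of cliques\<close>

definition simple_graph :: "'a set \<Rightarrow> 'a set set \<Rightarrow> bool" where
  "simple_graph V E \<longleftrightarrow> finite V \<and> (\<forall>e\<in>E. e \<subseteq> V \<and> card e = 2)"

definition adjacent :: "'a set set \<Rightarrow> 'a \<Rightarrow> 'a \<Rightarrow> bool" where
  "adjacent E u v \<longleftrightarrow> {u, v} \<in> E"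

definition clique :: "'a set \<Rightarrow> 'a set set \<Rightarrow> 'a set \<Rightarrow> bool" where
  "clique V E K \<longleftrightarrow> K \<subseteq> V \<and> (\<forall>u\<in>K. \<forall>v\<in>K. u \<noteq> v \<longrightarrow> adjacent E u v)"

definition all_or_none :: "'a set set \<Rightarrow> 'a \<Rightarrow> 'a set \<Rightarrow> bool" where
  "all_or_none E v K \<longleftrightarrow> (\<forall>x\<in>K. adjacent E v x) \<or> (\<forall>x\<in>K. \<not> adjacent E v x)"

definition homogeneous_pair_of_cliques ::
  "'a set \<Rightarrow> 'a set set \<Rightarrow> 'a set \<Rightarrow> 'a set \<Rightarrow> bool" where
  "homogeneous_pair_of_cliques V E A B \<longleftrightarrow>
     clique V E A \<and> clique V E B \<and> A \<noteq> {} \<and> B \<noteq> {} \<and> A \<inter> B = {} \<and> card (A \<union> B) \<ge> 3 \<and>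
     (\<forall>v \<in> V - (A \<union> B). all_or_none E v A \<and> all_or_none E v B)"

section \<open>Word RAM programs\<close>

text \<open>
  Running time is measured on a word RAM, programmed in a structured language over natural
  numbers.  A program refers to finitely many registers and finitely many zero-initialised arrays
  (segments of the random-access memory).  Every instruction and every test takes one time unit and
  does at most one addition, truncated subtraction or indirect memory access; there is no
  multiplication.  The parameter \<open>W\<close> of the semantics is the largest value that fits into a memory
  word: a write of a larger value has no transition, so that such a program does not terminate.
\<close>

type_synonym reg = string
type_synonym arr = string

datatype operand = Const nat | Reg reg

datatype test = Less operand operand | Equal operand operand | Unequal operand operand

datatype prog =
    Copy reg operand
  | Add reg operand operand
  | Sub reg operand operand
  | Load reg arr operand
  | Store arr operand operand
  | Seq prog prog
  | If test prog prog
  | While test prog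

record state =
  regs :: "reg \<Rightarrow> nat"
  arrs :: "arr \<Rightarrow> nat \<Rightarrow> nat"

fun val :: "operand \<Rightarrow> state \<Rightarrow> nat" where
  "val (Const k) s = k"
| "val (Reg x) s = regs s x"

fun holds :: "test \<Rightarrow> state \<Rightarrow> bool" where
  "holds (Less a b) s \<longleftrightarrow> val a s < val b s"
| "holds (Equal a b) s \<longleftrightarrow> val a s = val b s"
| "holds (Unequal a b) s \<longleftrightarrow> val a s \<noteq> val b s"

definition set_reg :: "reg \<Rightarrow> nat \<Rightarrow> state \<Rightarrow> state" where
  "set_reg x v s = s\<lparr>regs := (regs s)(x := v)\<rparr>"

definition set_arr :: "arr \<Rightarrow> nat \<Rightarrow> nat \<Rightarrow> state \<Rightarrow> state" where
  "set_arr a i v s = s\<lparr>arrs := (arrs s)(a := (arrs s a)(i := v))\<rparr>"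

text \<open>\<open>exec W p s t s'\<close>: started in \<open>s\<close>, the program \<open>p\<close> halts in \<open>s'\<close> after exactly \<open>t\<close> time units.\<close>

inductive exec :: "nat \<Rightarrow> prog \<Rightarrow> state \<Rightarrow> nat \<Rightarrow> state \<Rightarrow> bool" for W :: nat where
  Copy: "val a s \<le> W \<Longrightarrow> exec W (Copy x a) s 1 (set_reg x (val a s) s)"
| Add: "val a s + val b s \<le> W \<Longrightarrow> exec W (Add x a b) s 1 (set_reg x (val a s + val b s) s)"
| Sub: "val a s - val b s \<le> W \<Longrightarrow> exec W (Sub x a b) s 1 (set_reg x (val a s - val b s) s)"
| Load: "arrs s y (val a s) \<le> W \<Longrightarrow> exec W (Load x y a) s 1 (set_reg x (arrs s y (val a s)) s)"
| Store: "val b s \<le> W \<Longrightarrow> exec W (Store y a b) s 1 (set_arr y (val a s) (val b s) s)"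
| Seq: "exec W p s t s' \<Longrightarrow> exec W q s' t' s'' \<Longrightarrow> exec W (Seq p q) s (t + t') s''"
| IfTrue: "holds b s \<Longrightarrow> exec W p s t s' \<Longrightarrow> exec W (If b p q) s (1 + t) s'"
| IfFalse: "\<not> holds b s \<Longrightarrow> exec W q s t s' \<Longrightarrow> exec W (If b p q) s (1 + t) s'"
| WhileFalse: "\<not> holds b s \<Longrightarrow> exec W (While b p) s 1 s"
| WhileTrue: "holds b s \<Longrightarrow> exec W p s t s' \<Longrightarrow> exec W (While b p) s' t' s'' \<Longrightarrow>
    exec W (While b p) s (1 + t + t') s''"

inductive_cases exec_progE:
  "exec W (Copy x a) s t s'"
  "exec W (Add x a b) s t s'"
  "exec W (Sub x a b) s t s'"
  "exec W (Load x y a) s t s'"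
  "exec W (Store y a b) s t s'"
  "exec W (Seq p q) s t s'"
  "exec W (If b p q) s t s'"
  "exec W (While b p) s t s'"

text \<open>Programs are deterministic, so final state and running time are functions of the input.\<close>

lemma exec_deterministic:
  "exec W p s t s' \<Longrightarrow> exec W p s u s'' \<Longrightarrow> t = u \<and> s' = s''"
proof (induction arbitrary: u s'' rule: exec.induct)
  case (Copy a s x)
  from Copy.prems show ?case by (rule exec_progE(1)) simp
next
  case (Add a s b x)
  from Add.prems show ?case by (rule exec_progE(2)) simp
next
  case (Sub a s b x)
  from Sub.prems show ?case by (rule exec_progE(3)) simp
next
  case (Load s y a x)
  from Load.prems show ?case by (rule exec_progE(4)) simp
next
  case (Store b s y a)
  from Store.prems show ?case by (rule exec_progE(5)) simp
next
  case (Seq p s t s' q t' r)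
  from Seq.prems obtain t1 s1 t2 where u: "u = t1 + t2" "exec W p s t1 s1" "exec W q s1 t2 s''"
    by (rule exec_progE(6))
  from Seq.IH(1)[OF u(2)] Seq.IH(2)[of t2 s''] u show ?case by simp
next
  case (IfTrue b s p t s' q)
  from IfTrue.prems IfTrue.hyps(1) obtain t1 where u: "u = Suc t1" "exec W p s t1 s''"
    by (elim exec_progE(7)) simp_all
  from IfTrue.IH[OF u(2)] u(1) show ?case by simp
next
  case (IfFalse b s q t s' p)
  from IfFalse.prems IfFalse.hyps(1) obtain t1 where u: "u = Suc t1" "exec W q s t1 s''"
    by (elim exec_progE(7)) simp_all
  from IfFalse.IH[OF u(2)] u(1) show ?case by simp
next
  case (WhileFalse b s p)
  from WhileFalse.prems show ?case by (rule exec_progE(8)) (use WhileFalse.hyps in simp_all)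
next
  case (WhileTrue b s p t s' t' r)
  from WhileTrue.prems obtain t1 s1 t2
    where u: "u = Suc (t1 + t2)" "exec W p s t1 s1" "exec W (While b p) s1 t2 s''"
    by (rule exec_progE(8)) (use WhileTrue.hyps(1) in simp_all)
  from WhileTrue.IH(1)[OF u(2)] WhileTrue.IH(2)[of t2 s''] u show ?case by simp
qed

section \<open>Encoding of input and output\<close>

text \<open>
  The input graph has the vertices \<open>0, \<dots>, n - 1\<close> and is given by \<open>n\<close>, the number \<open>m\<close> of its edges
  and a list of its edges, in arbitrary order and orientation and without repetition.
\<close>

definition edge_list_of :: "nat set set \<Rightarrow> (nat \<times> nat) list \<Rightarrow> bool" where
  "edge_list_of E es \<longleftrightarrow> (\<lambda>(u, v). {u, v}) ` set es = E \<and> length es = card E"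

definition input :: "nat \<Rightarrow> (nat \<times> nat) list \<Rightarrow> state" where
  "input n es =
     \<lparr>regs = (\<lambda>_. 0)(''n'' := n, ''m'' := length es),
      arrs = (\<lambda>_ _. 0)(''src'' := (\<lambda>i. if i < length es then fst (es ! i) else 0),
                       ''dst'' := (\<lambda>i. if i < length es then snd (es ! i) else 0))\<rparr>"

text \<open>
  The answer is a flag, in register \<open>found\<close>, together with two vertex lists, stored in the arrays
  \<open>A\<close> and \<open>B\<close>, whose lengths are in the registers \<open>A\<close> and \<open>B\<close>.
\<close>

definition out_found :: "state \<Rightarrow> bool" where
  "out_found s \<longleftrightarrow> regs s ''found'' \<noteq> 0"

definition out_A :: "state \<Rightarrow> nat set" where
  "out_A s = {arrs s ''A'' i | i. i < regs s ''A''}"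

definition out_B :: "state \<Rightarrow> nat set" where
  "out_B s = {arrs s ''B'' i | i. i < regs s ''B''}"

definition correct_answer :: "nat set \<Rightarrow> nat set set \<Rightarrow> state \<Rightarrow> bool" where
  "correct_answer V E s \<longleftrightarrow>
     (if out_found s then homogeneous_pair_of_cliques V E (out_A s) (out_B s)
      else \<not> (\<exists>A B. homogeneous_pair_of_cliques V E A B))"

text \<open>
  \<open>p\<close> solves the problem within \<open>T m\<close> time units on every graph with \<open>m\<close> edges, using memory words
  of \<open>O(log (n + m))\<close> bits.
\<close>

definition finds_homogeneous_pair_in_time :: "prog \<Rightarrow> (nat \<Rightarrow> nat) \<Rightarrow> bool" where
  "finds_homogeneous_pair_in_time p T \<longleftrightarrow>
     (\<exists>c. \<forall>n E es. simple_graph {..<n} E \<longrightarrow> edge_list_of E es \<longrightarrow>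
        (\<exists>t s. exec ((n + card E + 2) ^ c) p (input n es) t s \<and>
               t \<le> T (card E) \<and> correct_answer {..<n} E s))"

end

theory Submission imports Defs begin

text \<open>
  Suppose that the edge \<open>uv\<close> lies in one side of a homogeneous pair, say \<open>A\<close>.  A vertex adjacent to
  exactly one of two known vertices of \<open>A\<close> must belong to \<open>B\<close>, and vice versa, so a chain
  \<open>A = [u, v]\<close> and an empty chain \<open>B\<close> grow by forced moves only.  When the moves end without a conflict,
  the chains form a homogeneous pair (with an arbitrary third vertex as \<open>B\<close> if \<open>B\<close> is empty);
  a conflict shows that no pair has \<open>u\<close> and \<open>v\<close> on the same side.  Some side of every homogeneous
  pair contains an edge, so it suffices to try every edge.

  It is enough to compare consecutive members \<open>p\<close>, \<open>x\<close> of a chain: a vertex that tells two members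
  apart tells two consecutive ones apart.  Scanning the neighbours of \<open>p\<close> and \<open>x\<close> costs
  \<open>O(deg p + deg x)\<close>, and each vertex occurs in at most one chain and in at most two of its
  consecutive pairs, so one edge costs \<open>O(m)\<close>.
\<close>

section \<open>Forced closure of an edge\<close>

text \<open>The time bound depends on \<open>m\<close> alone although \<open>n\<close> may be
  arbitrarily larger, so no step may visit all vertices or clear a table. This is why every chain
  member is kept non-isolated (its own degree then pays its fixed overhead) and why a spare third
  vertex is sought among 0, 1, 2 only.

  Growth is sound for all homogeneous pairs at once: every pair with \<open>u\<close> and
  \<open>v\<close> on side \<open>True\<close> contains both chains, and a cleared flag means that
  there is no such pair. A round does not stop at a conflict. Distinctness and disjointness of the
  chains survive it, so one degree count bounds failed and successful rounds alike.

  On entering a chain, a vertex is tested for adjacency only with the last member. That the whole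
  chain is a clique follows at the end from closedness: a member that told apart two consecutive
  members of its own chain would have been forced into the opposite chain too, which is a
  conflict.\<close>

type_synonym chains = "bool \<Rightarrow> nat list"

lemma adjacent_commute: "adjacent E u v \<longleftrightarrow> adjacent E v u"
  by (simp add: adjacent_def insert_commute)

text \<open>Without the two exclusions, adjacent \<open>p\<close> and \<open>x\<close> would tell
  themselves apart, since no vertex is adjacent to itself.\<close>

definition mixed :: "'a set set \<Rightarrow> 'a \<Rightarrow> 'a \<Rightarrow> 'a \<Rightarrow> bool" where
  "mixed E p x y \<longleftrightarrow> y \<noteq> p \<and> y \<noteq> x \<and> adjacent E p y \<noteq> adjacent E x y"

text \<open>A conflict only clears the flag and growth goes on. The test
  \<open>L \<tau> = []\<close> exempts the first member, which has no predecessor.\<close>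

fun push_chain :: "nat set set \<Rightarrow> bool \<Rightarrow> nat \<Rightarrow> chains \<times> bool \<Rightarrow> chains \<times> bool" where
  "push_chain E \<tau> y (L, ok) =
     (if y \<in> set (L (\<not> \<tau>)) then (L, False)
      else if y \<in> set (L \<tau>) then (L, ok)
      else (L(\<tau> := L \<tau> @ [y]), ok \<and> (L \<tau> = [] \<or> adjacent E (last (L \<tau>)) y)))"

definition scan_step :: "nat set set \<Rightarrow> bool \<Rightarrow> nat \<Rightarrow> nat \<Rightarrow> chains \<times> bool \<Rightarrow> chains \<times> bool" where
  "scan_step E \<tau> x y st = (if y = x \<or> adjacent E x y then st else push_chain E \<tau> y st)"

definition extends :: "chains \<times> bool \<Rightarrow> chains \<times> bool \<Rightarrow> bool" where
  "extends st st' \<longleftrightarrow> (\<forall>\<sigma>. \<exists>zs. fst st' \<sigma> = fst st \<sigma> @ zs) \<and> (snd st' \<longrightarrow> snd st)"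

lemma extends_refl [simp]: "extends st st"
  by (simp add: extends_def)

lemma extends_trans: "extends st st' \<Longrightarrow> extends st' st'' \<Longrightarrow> extends st st''"
  unfolding extends_def by (metis append_assoc)

lemma extends_nth: "extends st st' \<Longrightarrow> i < length (fst st \<sigma>) \<Longrightarrow> fst st' \<sigma> ! i = fst st \<sigma> ! i"
  unfolding extends_def by (metis nth_append)

lemma extends_length: "extends st st' \<Longrightarrow> length (fst st \<sigma>) \<le> length (fst st' \<sigma>)"
  unfolding extends_def by (metis le_add1 length_append)

lemma extends_set: "extends st st' \<Longrightarrow> set (fst st \<sigma>) \<subseteq> set (fst st' \<sigma>)"
  unfolding extends_def by (metis set_append sup.cobounded1)

lemma extends_push_chain: "extends st (push_chain E \<tau> y st)"
  by (cases st) (auto simp: extends_def)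

lemma push_chain_mem: "snd (push_chain E \<tau> y st) \<Longrightarrow> y \<in> set (fst (push_chain E \<tau> y st) \<tau>)"
  by (cases st) (auto split: if_splits)

lemma extends_scan_step: "extends st (scan_step E \<tau> x y st)"
  by (simp add: scan_step_def extends_push_chain)

lemma extends_fold_scan: "extends st (fold (scan_step E \<tau> x) ys st)"
proof (induction ys arbitrary: st)
  case (Cons y ys)
  show ?case unfolding fold_Cons comp_apply by (rule extends_trans[OF extends_scan_step Cons.IH])
qed simp

lemma fold_scan_mem:
  assumes "snd (fold (scan_step E \<tau> x) ys st)" "y \<in> set ys" "y \<noteq> x" "\<not> adjacent E x y"
  shows "y \<in> set (fst (fold (scan_step E \<tau> x) ys st) \<tau>)"
  using assms
proof (induction ys arbitrary: st)
  case (Cons z ys)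
  show ?case
  proof (cases "y = z")
    case True
    let ?st = "scan_step E \<tau> x z st"
    have ext: "extends ?st (fold (scan_step E \<tau> x) ys ?st)" by (rule extends_fold_scan)
    with Cons.prems(1) have "snd ?st" by (simp add: extends_def)
    with True Cons.prems(3,4) have "y \<in> set (fst ?st \<tau>)"
      by (simp add: scan_step_def push_chain_mem)
    with extends_set[OF ext] show ?thesis by auto
  qed (use Cons in auto)
qed simp

section \<open>Soundness of forced moves\<close>

definition pair_on :: "nat \<Rightarrow> nat set set \<Rightarrow> (bool \<Rightarrow> nat set) \<Rightarrow> bool" where
  "pair_on n E X \<longleftrightarrow> homogeneous_pair_of_cliques {..<n} E (X True) (X False)"

lemma pair_onD:
  assumes "pair_on n E X"
  shows "x \<in> X \<sigma> \<Longrightarrow> x < n"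
    and "x \<in> X \<sigma> \<Longrightarrow> y \<in> X \<sigma> \<Longrightarrow> x \<noteq> y \<Longrightarrow> adjacent E x y"
    and "x \<in> X \<sigma> \<Longrightarrow> x \<notin> X (\<not> \<sigma>)"
    and "y < n \<Longrightarrow> y \<notin> X \<sigma> \<Longrightarrow> y \<notin> X (\<not> \<sigma>) \<Longrightarrow> x \<in> X \<sigma> \<Longrightarrow> z \<in> X \<sigma> \<Longrightarrow>
      adjacent E x y \<longleftrightarrow> adjacent E z y"
  using assms
  by (cases \<sigma>; fastforce simp: pair_on_def homogeneous_pair_of_cliques_def clique_def all_or_none_def
      adjacent_commute)+

text \<open>Non-isolated members have positive degree, as the cost count requires. The clause on an
  empty chain \<open>False\<close> reflects that side \<open>True\<close> can grow only on evidence
  from the other side.\<close>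

definition chain_inv :: "nat \<Rightarrow> nat set set \<Rightarrow> nat \<Rightarrow> nat \<Rightarrow> chains \<times> bool \<Rightarrow> bool" where
  "chain_inv n E u v st \<longleftrightarrow>
     (\<forall>\<sigma>. distinct (fst st \<sigma>) \<and> set (fst st \<sigma>) \<subseteq> {y. y < n \<and> (\<exists>z. adjacent E y z)}) \<and>
     set (fst st True) \<inter> set (fst st False) = {} \<and>
     (snd st \<longrightarrow> (\<forall>\<sigma>. successively (adjacent E) (fst st \<sigma>))) \<and>
     (\<exists>zs. fst st True = u # v # zs) \<and>
     (fst st False = [] \<longrightarrow> fst st True = [u, v]) \<and>
     (\<forall>X. pair_on n E X \<and> u \<in> X True \<and> v \<in> X True \<longrightarrow> snd st \<and> (\<forall>\<sigma>. set (fst st \<sigma>) \<subseteq> X \<sigma>))"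

lemma chain_inv_disjoint:
  "chain_inv n E u v st \<Longrightarrow> x \<in> set (fst st \<sigma>) \<Longrightarrow> x \<notin> set (fst st (\<not> \<sigma>))"
  by (cases \<sigma>) (auto simp: chain_inv_def)

text \<open>Evidence for a move always consists of members of the opposite chain, whence
  \<open>nonempty\<close>. It preserves the clause on an empty chain \<open>False\<close>: side
  \<open>True\<close> receives a third member only when that chain is inhabited.\<close>

lemma chain_inv_push_chain:
  assumes inv: "chain_inv n E u v st"
    and y: "y < n" "adjacent E y z"
    and nonempty: "fst st (\<not> \<tau>) \<noteq> []"
    and forced: "\<And>X. pair_on n E X \<Longrightarrow> (\<And>\<sigma>. set (fst st \<sigma>) \<subseteq> X \<sigma>) \<Longrightarrow> y \<in> X \<tau>"
  shows "chain_inv n E u v (push_chain E \<tau> y st)"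
proof -
  obtain L ok where st: "st = (L, ok)" by (cases st)
  \<comment> \<open>A pair around \<open>u\<close> and \<open>v\<close> contains both chains by the
    invariant and then \<open>y\<close> by \<open>forced\<close>; disjointness and the clique
    property of its sides rule out both kinds of conflict.\<close>
  have sound: "y \<notin> set (L (\<not> \<tau>)) \<and> ok \<and> (\<forall>\<sigma>. set (L \<sigma>) \<subseteq> X \<sigma>) \<and> y \<in> X \<tau> \<and>
      (y \<notin> set (L \<tau>) \<longrightarrow> L \<tau> \<noteq> [] \<longrightarrow> adjacent E (last (L \<tau>)) y)"
    if X: "pair_on n E X" "u \<in> X True" "v \<in> X True" for X
  proof -
    have sub: "ok" "\<And>\<sigma>. set (L \<sigma>) \<subseteq> X \<sigma>" using inv X by (auto simp: chain_inv_def st)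
    have y\<tau>: "y \<in> X \<tau>" using forced[OF X(1)] sub by (simp add: st)
    moreover have "y \<notin> set (L (\<not> \<tau>))" using pair_onD(3)[OF X(1) y\<tau>] sub by blast
    moreover have "adjacent E (last (L \<tau>)) y" if "y \<notin> set (L \<tau>)" "L \<tau> \<noteq> []"
      using pair_onD(2)[OF X(1), of "last (L \<tau>)" \<tau> y] y\<tau> sub that last_in_set by blast
    ultimately show ?thesis using sub by blast
  qed
  show ?thesis
    using inv y nonempty sound unfolding chain_inv_def st
    by (cases \<tau>) (auto simp: successively_append_iff; metis)+
qed

text \<open>A vertex not adjacent to \<open>x\<close> cannot share a clique with it, and a vertex
  outside both cliques would see \<open>p\<close> and \<open>x\<close> alike. Only the opposite side
  remains for \<open>y\<close>.\<close>

lemma chain_inv_scan_step: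
  assumes inv: "chain_inv n E u v st" and graph: "simple_graph {..<n} E"
    and px: "p \<in> set (fst st (\<not> \<tau>))" "x \<in> set (fst st (\<not> \<tau>))" and adj: "adjacent E p y"
  shows "chain_inv n E u v (scan_step E \<tau> x y st)"
proof (cases "y = x \<or> adjacent E x y")
  case False
  have y: "y < n" using graph adj by (auto simp: simple_graph_def adjacent_def)
  have "y \<in> X \<tau>" if X: "pair_on n E X" and sub: "\<And>\<sigma>. set (fst st \<sigma>) \<subseteq> X \<sigma>" for X
  proof -
    have pxX: "p \<in> X (\<not> \<tau>)" "x \<in> X (\<not> \<tau>)" using px sub by auto
    have "y \<notin> X (\<not> \<tau>)" using pair_onD(2)[OF X pxX(2)] False by blast
    then show ?thesis using pair_onD(4)[OF X y, of "\<not> \<tau>" p x] pxX adj False by auto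
  qed
  moreover have "fst st (\<not> \<tau>) \<noteq> []" using px by auto
  ultimately have "chain_inv n E u v (push_chain E \<tau> y st)"
    using chain_inv_push_chain[OF inv y, of p \<tau>] adj by (metis adjacent_commute)
  then show ?thesis using False by (simp add: scan_step_def)
qed (auto simp: scan_step_def inv)

lemma chain_inv_fold_scan:
  assumes "chain_inv n E u v st" and graph: "simple_graph {..<n} E"
    and "p \<in> set (fst st (\<not> \<tau>))" "x \<in> set (fst st (\<not> \<tau>))" and "\<forall>y\<in>set ys. adjacent E p y"
  shows "chain_inv n E u v (fold (scan_step E \<tau> x) ys st)"
  using assms
proof (induction ys arbitrary: st)
  case (Cons y ys)
  have "set (fst st (\<not> \<tau>)) \<subseteq> set (fst (scan_step E \<tau> x y st) (\<not> \<tau>))"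
    by (intro extends_set extends_scan_step)
  then have "p \<in> set (fst (scan_step E \<tau> x y st) (\<not> \<tau>))" "x \<in> set (fst (scan_step E \<tau> x y st) (\<not> \<tau>))"
    using Cons.prems(3,4) by auto
  moreover have "chain_inv n E u v (scan_step E \<tau> x y st)"
    using chain_inv_scan_step[OF Cons.prems(1-4), of y] Cons.prems(5) by simp
  ultimately show ?case
    unfolding fold_Cons comp_apply by (intro Cons.IH graph) (use Cons.prems(5) in auto)
qed simp

text \<open>Two scans, since a vertex telling \<open>p\<close> and \<open>x\<close> apart may be a
  neighbour of either one.\<close>

definition expand :: "nat set set \<Rightarrow> (nat \<Rightarrow> nat list) \<Rightarrow> bool \<Rightarrow> nat \<Rightarrow> nat \<Rightarrow> chains \<times> bool \<Rightarrow> chains \<times> bool" where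
  "expand E N \<sigma> p x st =
     fold (scan_step E (\<not> \<sigma>) p) (N x) (fold (scan_step E (\<not> \<sigma>) x) (N p) st)"

text \<open>\<open>H \<sigma>\<close> counts the processed members of a chain: exactly the
  consecutive pairs with upper index below \<open>H \<sigma>\<close> are done. After a conflict
  nothing is promised.\<close>

definition closed_upto :: "nat set set \<Rightarrow> chains \<times> bool \<Rightarrow> (bool \<Rightarrow> nat) \<Rightarrow> bool" where
  "closed_upto E st H \<longleftrightarrow> (snd st \<longrightarrow> (\<forall>\<sigma> i y. Suc i < H \<sigma> \<longrightarrow> Suc i < length (fst st \<sigma>) \<longrightarrow>
     mixed E (fst st \<sigma> ! i) (fst st \<sigma> ! Suc i) y \<longrightarrow> y \<in> set (fst st (\<not> \<sigma>))))"

lemma closed_uptoD: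
  "closed_upto E (L, True) H \<Longrightarrow> Suc i < H \<sigma> \<Longrightarrow> Suc i < length (L \<sigma>) \<Longrightarrow>
    mixed E (L \<sigma> ! i) (L \<sigma> ! Suc i) y \<Longrightarrow> y \<in> set (L (\<not> \<sigma>))"
  unfolding closed_upto_def by (metis fst_conv snd_conv)

lemma extends_expand: "extends st (expand E N \<sigma> p x st)"
  unfolding expand_def by (rule extends_trans; rule extends_fold_scan)

lemma expand_mem:
  assumes "snd (expand E N \<sigma> p x st)" "mixed E p x y"
    and N: "\<And>v. set (N v) = {w. adjacent E v w}"
  shows "y \<in> set (fst (expand E N \<sigma> p x st) (\<not> \<sigma>))"
proof -
  let ?st = "fold (scan_step E (\<not> \<sigma>) x) (N p) st"
  have ext: "extends ?st (expand E N \<sigma> p x st)" unfolding expand_def by (rule extends_fold_scan)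
  show ?thesis
  proof (cases "adjacent E p y")
    case True
    have "y \<in> set (fst ?st (\<not> \<sigma>))"
      by (rule fold_scan_mem) (use True assms ext in \<open>auto simp: mixed_def extends_def\<close>)
    then show ?thesis using extends_set[OF ext] by blast
  next
    case False
    then show ?thesis unfolding expand_def
      by (intro fold_scan_mem) (use assms in \<open>auto simp: mixed_def expand_def\<close>)
  qed
qed

lemma chain_inv_expand:
  assumes inv: "chain_inv n E u v st" and graph: "simple_graph {..<n} E"
    and px: "p \<in> set (fst st \<sigma>)" "x \<in> set (fst st \<sigma>)"
    and N: "\<And>v. set (N v) = {w. adjacent E v w}"
  shows "chain_inv n E u v (expand E N \<sigma> p x st)"
proof -
  let ?st = "fold (scan_step E (\<not> \<sigma>) x) (N p) st"
  have "chain_inv n E u v ?st"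
    by (rule chain_inv_fold_scan[OF inv graph, of p]) (use px N in auto)
  then show ?thesis unfolding expand_def
    by (rule chain_inv_fold_scan[OF _ graph, of _ _ _ x])
       (use px extends_set[OF extends_fold_scan, of st \<sigma> E "\<not> \<sigma>" x "N p"] N in auto)
qed

lemma closed_upto_expand:
  assumes inv: "chain_inv n E u v st" and closed: "closed_upto E st H"
    and H: "1 \<le> H \<sigma>" "H \<sigma> < length (fst st \<sigma>)" "\<And>\<tau>. H \<tau> \<le> max 1 (length (fst st \<tau>))"
    and N: "\<And>v. set (N v) = {w. adjacent E v w}"
  shows "closed_upto E (expand E N \<sigma> (fst st \<sigma> ! (H \<sigma> - 1)) (fst st \<sigma> ! H \<sigma>) st) (H(\<sigma> := Suc (H \<sigma>)))"
proof -
  let ?st = "expand E N \<sigma> (fst st \<sigma> ! (H \<sigma> - 1)) (fst st \<sigma> ! H \<sigma>) st"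
  have ext: "extends st ?st" by (rule extends_expand)
  have "y \<in> set (fst ?st (\<not> \<rho>))"
    if ok: "snd ?st" and i: "Suc i < (H(\<sigma> := Suc (H \<sigma>))) \<rho>"
      and mix: "mixed E (fst ?st \<rho> ! i) (fst ?st \<rho> ! Suc i) y" for \<rho> i y
  \<comment> \<open>The one new pair has upper index \<open>H \<sigma>\<close>; older pairs keep
    their entries because chains grow only at the end.\<close>
  proof (cases "\<rho> = \<sigma> \<and> Suc i = H \<sigma>")
    case True
    then have "mixed E (fst st \<sigma> ! (H \<sigma> - 1)) (fst st \<sigma> ! H \<sigma>) y"
      using mix H(2) extends_nth[OF ext, of "H \<sigma>" \<sigma>] extends_nth[OF ext, of i \<sigma>]
          by (auto simp: True[THEN conjunct2, symmetric])
    then show ?thesis using expand_mem[OF ok _ N] True by blast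
  next
    case False
    then have i': "Suc i < H \<rho>" using i by (auto split: if_splits)
    then have len: "Suc i < length (fst st \<rho>)" using H(3)[of \<rho>] by auto
    have "mixed E (fst st \<rho> ! i) (fst st \<rho> ! Suc i) y"
      using mix len extends_nth[OF ext, of _ \<rho>] by auto
    moreover have "snd st" using ok ext by (simp add: extends_def)
    ultimately have "y \<in> set (fst st (\<not> \<rho>))" using closed i' len by (auto simp: closed_upto_def)
    then show ?thesis using extends_set[OF ext] by blast
  qed
  then show ?thesis by (auto simp: closed_upto_def)
qed

section \<open>From closed chains to a homogeneous pair\<close>

text \<open>Backward induction from the tested adjacency of members \<open>j - 1\<close> and
  \<open>j\<close>: member \<open>j\<close> is not in the opposite chain, so it does not tell
  members \<open>k\<close> and \<open>k + 1\<close> apart, and adjacency passes down.\<close>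

lemma closed_upto_clique:
  assumes inv: "chain_inv n E u v (L, True)" and closed: "closed_upto E (L, True) H"
    and H: "length (L \<sigma>) \<le> H \<sigma>" and ij: "i < j" "j < length (L \<sigma>)"
  shows "adjacent E (L \<sigma> ! i) (L \<sigma> ! j)"
proof -
  have succ: "successively (adjacent E) (L \<sigma>)" and dist: "distinct (L \<sigma>)"
    using inv by (auto simp: chain_inv_def)
  have "i \<le> j - 1" using ij by simp
  then show ?thesis
  proof (induction rule: inc_induct)
    case base
    have "Suc (j - 1) = j" using ij by simp
    then show ?case using succ ij by (metis successively_conv_nth)
  next
    case (step k)
    have k: "Suc k < j" using step.hyps by simp
    have "L \<sigma> ! j \<notin> set (L (\<not> \<sigma>))" using chain_inv_disjoint[OF inv] ij by simp
    then have "\<not> mixed E (L \<sigma> ! k) (L \<sigma> ! Suc k) (L \<sigma> ! j)"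
      using closed_uptoD[OF closed, of k \<sigma>] H k ij by (meson less_le_trans less_trans)
    then show ?case using step.IH dist k ij by (auto simp: mixed_def nth_eq_iff_index_eq)
  qed
qed

lemma closed_upto_uniform:
  assumes closed: "closed_upto E (L, True) H"
    and H: "length (L \<sigma>) \<le> H \<sigma>" and y: "y \<notin> set (L \<sigma>)" "y \<notin> set (L (\<not> \<sigma>))"
    and i: "i < length (L \<sigma>)"
  shows "adjacent E (L \<sigma> ! i) y \<longleftrightarrow> adjacent E (L \<sigma> ! 0) y"
  using i
proof (induction i)
  case (Suc i)
  have "\<not> mixed E (L \<sigma> ! i) (L \<sigma> ! Suc i) y" using closed_uptoD[OF closed, of i \<sigma>] H y Suc.prems
      by (meson less_le_trans)
  moreover have "y \<noteq> L \<sigma> ! i" "y \<noteq> L \<sigma> ! Suc i" using y Suc.prems by auto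
  ultimately show ?case using Suc by (auto simp: mixed_def)
qed simp

lemma closed_homogeneous_pair:
  assumes inv: "chain_inv n E u v (L, True)" and closed: "closed_upto E (L, True) H"
    and H: "\<And>\<sigma>. length (L \<sigma>) \<le> H \<sigma>" and n: "w < n" "w \<noteq> u" "w \<noteq> v"
  shows "homogeneous_pair_of_cliques {..<n} E (set (L True))
    (if L False = [] then {w} else set (L False))"
proof -
  have cl: "clique {..<n} E (set (L \<sigma>))" for \<sigma>
  proof -
    have "adjacent E x y" if xy: "x \<in> set (L \<sigma>)" "y \<in> set (L \<sigma>)" "x \<noteq> y" for x y
    proof -
      obtain i j where "i < length (L \<sigma>)" "j < length (L \<sigma>)" "x = L \<sigma> ! i" "y = L \<sigma> ! j" "i \<noteq> j"
        using xy by (metis in_set_conv_nth)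
      then show ?thesis using closed_upto_clique[OF inv closed H, of i j \<sigma>]
          closed_upto_clique[OF inv closed H, of j i \<sigma>]
        by (metis adjacent_commute linorder_neqE_nat)
    qed
    then show ?thesis using inv by (force simp: clique_def chain_inv_def)
  qed
  have un: "all_or_none E y (set (L \<sigma>))" if "y \<notin> set (L \<sigma>)" "y \<notin> set (L (\<not> \<sigma>))" for y \<sigma>
  proof -
    have "adjacent E x y \<longleftrightarrow> adjacent E (L \<sigma> ! 0) y" if "x \<in> set (L \<sigma>)" for x
      using that closed_upto_uniform[OF closed H \<open>y \<notin> set (L \<sigma>)\<close> \<open>y \<notin> set (L (\<not> \<sigma>))\<close>]
      by (auto simp: in_set_conv_nth)
    then show ?thesis unfolding all_or_none_def by (metis adjacent_commute)
  qed
  obtain zs where zs: "L True = u # v # zs" using inv by (auto simp: chain_inv_def)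
  have uv: "u \<noteq> v" using inv zs by (auto simp: chain_inv_def dest: spec[of _ True])
  have disj: "set (L True) \<inter> set (L False) = {}" using inv by (simp add: chain_inv_def)
  have sub: "{u, v} \<subseteq> set (L True)" using zs by simp
  show ?thesis
  proof (cases "L False = []")
    case True
    \<comment> \<open>The invariant leaves just \<open>u\<close> and \<open>v\<close> on side
      \<open>True\<close>. The conditions on the singleton \<open>{w}\<close> are trivial, and
      \<open>w\<close> brings the size to 3.\<close>
    then have "L True = [u, v]" using inv by (simp add: chain_inv_def)
    with True uv n un[of _ True] cl[of True] show ?thesis
      by (auto simp: homogeneous_pair_of_cliques_def clique_def all_or_none_def)
  next
    case False
    then obtain b where b: "b \<in> set (L False)" by (cases "L False") auto
    have "card {u, v, b} \<le> card (set (L True) \<union> set (L False))"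
      by (rule card_mono) (use sub b in auto)
    moreover have "u \<noteq> b" "v \<noteq> b" using sub b disj by auto
    then have "card {u, v, b} = 3" using uv by simp
    ultimately show ?thesis using False cl disj sub b un[of _ True] un[of _ False]
      by (auto simp: homogeneous_pair_of_cliques_def)
  qed
qed

lemma homogeneous_pair_commute:
  "homogeneous_pair_of_cliques V E A B \<Longrightarrow> homogeneous_pair_of_cliques V E B A"
  by (auto simp: homogeneous_pair_of_cliques_def Un_commute Int_commute)

text \<open>Three vertices on two sides put two on one side. Swapping the sides makes it side
  \<open>True\<close>, so edges need to be tried on that side only.\<close>

lemma homogeneous_pair_contains_edge:
  assumes "homogeneous_pair_of_cliques {..<n} E A B"
  obtains X u v where "pair_on n E X" "u \<in> X True" "v \<in> X True" "{u, v} \<in> E"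
proof -
  have "\<not> card A \<le> 1 \<or> \<not> card B \<le> 1"
    using assms card_Un_le[of A B] by (auto simp: homogeneous_pair_of_cliques_def)
  then obtain A' B' where h: "homogeneous_pair_of_cliques {..<n} E A' B'" "\<not> card A' \<le> 1"
    using assms homogeneous_pair_commute by blast
  then obtain u v where uv: "u \<in> A'" "v \<in> A'" "u \<noteq> v"
    by (metis card_le_Suc0_iff_eq card.infinite zero_le_one One_nat_def)
  with h have "{u, v} \<in> E"
    by (auto simp: homogeneous_pair_of_cliques_def clique_def adjacent_def)
  then show thesis using h uv
    by (intro that[of "\<lambda>\<sigma>. if \<sigma> then A' else B'"]) (auto simp: pair_on_def)
qed

lemma homogeneous_pair_order: "homogeneous_pair_of_cliques {..<n} E A B \<Longrightarrow> 3 \<le> (n :: nat)"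
  using card_mono[of "{..<n}" "A \<union> B"] by (auto simp: homogeneous_pair_of_cliques_def clique_def)

section \<open>Degree count for one closure\<close>

text \<open>Each summand measures the two scans of one consecutive pair; the extra 1 stands for the
  fixed overhead of handling it.\<close>

definition scan_work :: "(nat \<Rightarrow> nat list) \<Rightarrow> chains \<Rightarrow> (bool \<Rightarrow> nat) \<Rightarrow> bool \<Rightarrow> nat" where
  "scan_work N L H \<sigma> = (\<Sum>i\<in>{1..<H \<sigma>}. length (N (L \<sigma> ! (i - 1))) + length (N (L \<sigma> ! i)) + 1)"

text \<open>The factor 3 adds three counts: an entry is the lower member of at most one pair, the
  upper member of at most one pair, and its positive weight absorbs the 1.\<close>

lemma sum_consecutive_le:
  fixes f :: "'a \<Rightarrow> nat"
  assumes "distinct xs" "h \<le> max 1 (length xs)" "\<And>x. x \<in> set xs \<Longrightarrow> 1 \<le> f x"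
  shows "(\<Sum>i\<in>{1..<h}. f (xs ! (i - 1)) + f (xs ! i) + 1) \<le> 3 * sum f (set xs)"
proof -
  have eq: "sum f (set xs) = (\<Sum>i<length xs. f (xs ! i))"
    using assms(1) by (simp add: sum_list_distinct_conv_sum_set[symmetric] sum_list_sum_nth atLeast0LessThan)
  have sub: "{1..<h} \<subseteq> {..<length xs}" using assms(2) by auto
  have "(\<Sum>i\<in>{1..<h}. f (xs ! (i - 1))) = (\<Sum>i\<in>{..<h - 1}. f (xs ! i))"
    by (rule sum.reindex_bij_witness[of _ Suc "\<lambda>i. i - 1"]) auto
  also have "\<dots> \<le> sum f (set xs)" unfolding eq by (rule sum_mono2) (use assms(2) in auto)
  finally have 1: "(\<Sum>i\<in>{1..<h}. f (xs ! (i - 1))) \<le> sum f (set xs)" .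
  have 2: "(\<Sum>i\<in>{1..<h}. f (xs ! i)) \<le> sum f (set xs)"
    unfolding eq by (rule sum_mono2[OF _ sub]) auto
  have "(\<Sum>i\<in>{1..<h}. 1) \<le> (\<Sum>i\<in>{1..<h}. f (xs ! i))"
    by (rule sum_mono) (use assms(3) sub in force)
  with 1 2 show ?thesis by (simp add: sum.distrib del: sum_constant One_nat_def)
qed

text \<open>Disjointness of the chains merges their two bounds into one sum over distinct vertices,
  so the factor 3 is not doubled.\<close>

lemma scan_work_le:
  assumes inv: "chain_inv n E u v (L, ok)" and H: "\<And>\<sigma>. H \<sigma> \<le> max 1 (length (L \<sigma>))"
    and N: "\<And>v. set (N v) = {w. adjacent E v w}"
  shows "scan_work N L H True + scan_work N L H False \<le> 3 * (\<Sum>v<n. length (N v))"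
proof -
  let ?f = "\<lambda>v. length (N v)"
  have "scan_work N L H \<sigma> \<le> 3 * sum ?f (set (L \<sigma>))" for \<sigma>
    unfolding scan_work_def
  proof (rule sum_consecutive_le)
    show "distinct (L \<sigma>)" using inv by (auto simp: chain_inv_def)
    fix x assume "x \<in> set (L \<sigma>)"
    then have "\<exists>z. adjacent E x z" using inv by (auto simp: chain_inv_def)
    then have "N x \<noteq> []" using N[of x] by auto
    then show "1 \<le> length (N x)" by (simp add: Suc_leI)
  qed (use H in auto)
  then have "scan_work N L H True + scan_work N L H False
      \<le> 3 * (sum ?f (set (L True)) + sum ?f (set (L False)))"
    by (simp add: add_mono distrib_left)
  also have "sum ?f (set (L True)) + sum ?f (set (L False)) = sum ?f (set (L True) \<union> set (L False))"
    using inv by (subst sum.union_disjoint) (auto simp: chain_inv_def)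
  also have "\<dots> \<le> sum ?f {..<n}"
    using inv by (intro sum_mono2) (auto simp: chain_inv_def)
  finally show ?thesis by simp
qed

lemma scan_work_step:
  assumes "extends (L, ok) (L', ok')" "\<And>\<tau>. H \<tau> \<le> max 1 (length (L \<tau>))"
    and "1 \<le> H \<sigma>" "H \<sigma> < length (L \<sigma>)"
  shows "scan_work N L' (H(\<sigma> := Suc (H \<sigma>))) \<tau> = scan_work N L H \<tau> +
    (if \<tau> = \<sigma> then length (N (L \<sigma> ! (H \<sigma> - 1))) + length (N (L \<sigma> ! H \<sigma>)) + 1 else 0)"
proof -
  have nth: "L' \<tau> ! i = L \<tau> ! i" if "i < length (L \<tau>)" for i \<tau>
    using extends_nth[OF assms(1), of i \<tau>] that by simp
  have "scan_work N L' H \<tau> = scan_work N L H \<tau>"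
    unfolding scan_work_def by (rule sum.cong) (use assms(2)[of \<tau>] nth in auto)
  then show ?thesis using assms(3,4) nth by (auto simp: scan_work_def)
qed

lemma chain_inv_init:
  assumes graph: "simple_graph {..<n} E" and "{u, v} \<in> E"
  shows "chain_inv n E u v (\<lambda>\<sigma>. if \<sigma> then [u, v] else [], True)"
proof -
  have uv: "u < n" "v < n" "u \<noteq> v" "adjacent E u v" "adjacent E v u"
    using assms by (auto simp: simple_graph_def adjacent_def insert_commute)
  then show ?thesis by (auto simp: chain_inv_def split: if_splits)
qed

section \<open>Timed weakest preconditions\<close>

text \<open>The existential form makes termination part of the claim, and \<open>t\<close> is the
  exact running time.\<close>

definition wp :: "nat \<Rightarrow> prog \<Rightarrow> (nat \<Rightarrow> state \<Rightarrow> bool) \<Rightarrow> state \<Rightarrow> bool" where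
  "wp W p Q s \<longleftrightarrow> (\<exists>t s'. exec W p s t s' \<and> Q t s')"

lemma wp_Copy: "wp W (Copy x a) Q s \<longleftrightarrow> val a s \<le> W \<and> Q (Suc 0) (set_reg x (val a s) s)"
  unfolding wp_def by (blast elim: exec_progE intro: exec.Copy[unfolded One_nat_def])

lemma wp_Add: "wp W (Add x a b) Q s \<longleftrightarrow> val a s + val b s \<le> W \<and> Q (Suc 0) (set_reg x (val a s + val b s) s)"
  unfolding wp_def by (blast elim: exec_progE intro: exec.Add[unfolded One_nat_def])

lemma wp_Sub: "wp W (Sub x a b) Q s \<longleftrightarrow> val a s - val b s \<le> W \<and> Q (Suc 0) (set_reg x (val a s - val b s) s)"
  unfolding wp_def by (blast elim: exec_progE intro: exec.Sub[unfolded One_nat_def])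

lemma wp_Load: "wp W (Load x y a) Q s \<longleftrightarrow>
    arrs s y (val a s) \<le> W \<and> Q (Suc 0) (set_reg x (arrs s y (val a s)) s)"
  unfolding wp_def by (blast elim: exec_progE intro: exec.Load[unfolded One_nat_def])

lemma wp_Store: "wp W (Store y a b) Q s \<longleftrightarrow> val b s \<le> W \<and> Q (Suc 0) (set_arr y (val a s) (val b s) s)"
  unfolding wp_def by (blast elim: exec_progE intro: exec.Store[unfolded One_nat_def])

lemma wp_Seq: "wp W (Seq p q) Q s \<longleftrightarrow> wp W p (\<lambda>t. wp W q (\<lambda>t'. Q (t + t'))) s"
  unfolding wp_def by (blast elim: exec_progE(6) intro: exec.Seq)

lemma wp_If: "wp W (If b p q) Q s \<longleftrightarrow>
    (holds b s \<longrightarrow> wp W p (\<lambda>t. Q (Suc t)) s) \<and> (\<not> holds b s \<longrightarrow> wp W q (\<lambda>t. Q (Suc t)) s)"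
  unfolding wp_def
  by (cases "holds b s")
     (simp_all, (blast elim: exec_progE(7) intro: exec.IfTrue[unfolded plus_1_eq_Suc]
        exec.IfFalse[unfolded plus_1_eq_Suc])+)

lemmas wp_simps = wp_Copy wp_Add wp_Sub wp_Load wp_Store wp_Seq wp_If

lemma wp_mono: "wp W p Q s \<Longrightarrow> (\<And>t s'. Q t s' \<Longrightarrow> Q' t s') \<Longrightarrow> wp W p Q' s"
  unfolding wp_def by blast

text \<open>
  The potential \<open>\<phi>\<close> of the ghost state \<open>g\<close> pays for the test and the body of each iteration, so that
  it bounds the running time and proves termination at once.
\<close>

lemma wp_While:
  assumes body: "\<And>g s. I g s \<Longrightarrow> holds b s \<Longrightarrow>
      wp W p (\<lambda>t s'. \<exists>g'. I g' s' \<and> 1 + t + \<phi> g' \<le> (\<phi> g :: nat)) s"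
    and "I g s"
  shows "wp W (While b p) (\<lambda>t s'. \<exists>g'. I g' s' \<and> \<not> holds b s' \<and> t + \<phi> g' \<le> 1 + \<phi> g) s"
  using assms(2)
proof (induction "\<phi> g" arbitrary: g s rule: less_induct)
  case less
  show ?case
  proof (cases "holds b s")
    case True
    from body[OF less.prems True] obtain t s' g' where
      1: "exec W p s t s'" "I g' s'" "1 + t + \<phi> g' \<le> \<phi> g" unfolding wp_def by blast
    then have "\<phi> g' < \<phi> g" by simp
    from less.hyps[OF this 1(2)] obtain t' s'' g'' where
      2: "exec W (While b p) s' t' s''" "I g'' s''" "\<not> holds b s''" "t' + \<phi> g'' \<le> 1 + \<phi> g'"
      unfolding wp_def by blast
    have "exec W (While b p) s (1 + t + t') s''" by (rule exec.WhileTrue[OF True 1(1) 2(1)])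
    with 1 2 show ?thesis unfolding wp_def
      by (intro exI[of _ "1 + t + t'"] exI[of _ s''] conjI exI[of _ g'']) auto
  next
    case False
    with less.prems show ?thesis unfolding wp_def
      by (intro exI[of _ 1] exI[of _ s] conjI exec.WhileFalse exI[of _ g]) auto
  qed
qed

lemma regs_set_reg [simp]: "regs (set_reg x v s) = (regs s)(x := v)"
  and arrs_set_reg [simp]: "arrs (set_reg x v s) = arrs s"
  and regs_set_arr [simp]: "regs (set_arr a i v s) = regs s"
  and arrs_set_arr [simp]: "arrs (set_arr a i v s) = (arrs s)(a := (arrs s a)(i := v))"
  by (simp_all add: set_reg_def set_arr_def)

section \<open>The program\<close>

abbreviation seq :: "prog \<Rightarrow> prog \<Rightarrow> prog" (infixr ";;" 60) where
  "p ;; q \<equiv> Seq p q"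

abbreviation skip :: prog where
  "skip \<equiv> Copy ''z'' (Const 0)"

text \<open>
  The first endpoint of an edge that mentions a vertex reserves for it the next \<open>n\<close> cells of the
  arrays \<open>adj\<close> (row of the adjacency matrix) and \<open>nbr\<close> (list of its \<open>deg\<close> neighbours), beginning at
  \<open>off\<close>.  Isolated vertices keep the offset 0 and the never written cells \<open>0, \<dots>, n - 1\<close>, so no time
  is spent on them.
\<close>

definition insert_half :: "reg \<Rightarrow> reg \<Rightarrow> prog" where
  "insert_half x y =
     Load ''o'' ''off'' (Reg x);;
     If (Equal (Reg ''o'') (Const 0))
       (Add ''c'' (Reg ''c'') (Reg ''n'');; Copy ''o'' (Reg ''c'');; Store ''off'' (Reg x) (Reg ''o''))
       skip;;
     Add ''p'' (Reg ''o'') (Reg y);; Store ''adj'' (Reg ''p'') (Const 1);;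
     Load ''d'' ''deg'' (Reg x);;
     Add ''p'' (Reg ''o'') (Reg ''d'');; Store ''nbr'' (Reg ''p'') (Reg y);;
     Add ''d'' (Reg ''d'') (Const 1);; Store ''deg'' (Reg x) (Reg ''d'')"

definition build_body :: prog where
  "build_body =
     Load ''u'' ''src'' (Reg ''k'');; Load ''v'' ''dst'' (Reg ''k'');;
     insert_half ''u'' ''v'';; insert_half ''v'' ''u'';; Add ''k'' (Reg ''k'') (Const 1)"

definition build :: prog where
  "build = Copy ''k'' (Const 0);; While (Less (Reg ''k'') (Reg ''m'')) build_body"

text \<open>
  Side \<open>True\<close> is \<open>A\<close> and side \<open>False\<close> is \<open>B\<close>.  The mark of a vertex on a side is the number of the last
  round (counted from 1) that put it there, so marks need not be erased between rounds.
\<close>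

definition chain_name :: "bool \<Rightarrow> string" where
  "chain_name \<sigma> = (if \<sigma> then ''A'' else ''B'')"

definition mark_name :: "bool \<Rightarrow> arr" where
  "mark_name \<sigma> = (if \<sigma> then ''markA'' else ''markB'')"

definition head_name :: "bool \<Rightarrow> reg" where
  "head_name \<sigma> = (if \<sigma> then ''headA'' else ''headB'')"

lemma names_eq [simp]:
  "chain_name \<sigma> = chain_name \<tau> \<longleftrightarrow> \<sigma> = \<tau>" "mark_name \<sigma> = mark_name \<tau> \<longleftrightarrow> \<sigma> = \<tau>"
  "head_name \<sigma> = head_name \<tau> \<longleftrightarrow> \<sigma> = \<tau>"
  "chain_name \<sigma> \<noteq> mark_name \<tau>" "mark_name \<sigma> \<noteq> chain_name \<tau>"
  "chain_name \<sigma> \<noteq> head_name \<tau>" "head_name \<sigma> \<noteq> chain_name \<tau>"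
  by (auto simp: chain_name_def mark_name_def head_name_def)

lemma names_neq_literal [simp]:
  "r \<notin> {''A'', ''B''} \<Longrightarrow> chain_name \<sigma> \<noteq> r" "r \<notin> {''A'', ''B''} \<Longrightarrow> r \<noteq> chain_name \<sigma>"
  "r \<notin> {''markA'', ''markB''} \<Longrightarrow> mark_name \<sigma> \<noteq> r" "r \<notin> {''markA'', ''markB''} \<Longrightarrow> r \<noteq> mark_name \<sigma>"
  "r \<notin> {''headA'', ''headB''} \<Longrightarrow> head_name \<sigma> \<noteq> r" "r \<notin> {''headA'', ''headB''} \<Longrightarrow> r \<noteq> head_name \<sigma>"
  by (auto simp: chain_name_def mark_name_def head_name_def)

definition push :: "bool \<Rightarrow> prog" where
  "push \<tau> =
     Load ''e'' (mark_name (\<not> \<tau>)) (Reg ''y'');;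
     If (Equal (Reg ''e'') (Reg ''k'')) (Copy ''ok'' (Const 0))
      (Load ''e'' (mark_name \<tau>) (Reg ''y'');;
       If (Equal (Reg ''e'') (Reg ''k'')) skip
        (Store (mark_name \<tau>) (Reg ''y'') (Reg ''k'');;
         If (Equal (Reg (chain_name \<tau>)) (Const 0)) skip
          (Sub ''e'' (Reg (chain_name \<tau>)) (Const 1);; Load ''e'' (chain_name \<tau>) (Reg ''e'');;
           Load ''e'' ''off'' (Reg ''e'');; Add ''e'' (Reg ''e'') (Reg ''y'');;
           Load ''e'' ''adj'' (Reg ''e'');; If (Equal (Reg ''e'') (Const 0)) (Copy ''ok'' (Const 0)) skip);;
         Store (chain_name \<tau>) (Reg (chain_name \<tau>)) (Reg ''y'');;
         Add (chain_name \<tau>) (Reg (chain_name \<tau>)) (Const 1)))"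

definition scan_body :: "bool \<Rightarrow> reg \<Rightarrow> prog" where
  "scan_body \<tau> x =
     Add ''e'' (Reg ''o'') (Reg ''i'');; Load ''y'' ''nbr'' (Reg ''e'');; Add ''i'' (Reg ''i'') (Const 1);;
     If (Equal (Reg ''y'') (Reg x)) skip
      (Add ''e'' (Reg ''q'') (Reg ''y'');; Load ''e'' ''adj'' (Reg ''e'');;
       If (Equal (Reg ''e'') (Const 0)) (push \<tau>) skip)"

definition scan :: "bool \<Rightarrow> reg \<Rightarrow> reg \<Rightarrow> prog" where
  "scan \<tau> p x =
     Load ''d'' ''deg'' (Reg p);; Load ''o'' ''off'' (Reg p);; Load ''q'' ''off'' (Reg x);;
     Copy ''i'' (Const 0);; While (Less (Reg ''i'') (Reg ''d'')) (scan_body \<tau> x)"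

definition process :: "bool \<Rightarrow> prog" where
  "process \<sigma> =
     Sub ''e'' (Reg (head_name \<sigma>)) (Const 1);; Load ''p'' (chain_name \<sigma>) (Reg ''e'');;
     Load ''x'' (chain_name \<sigma>) (Reg (head_name \<sigma>));;
     Add (head_name \<sigma>) (Reg (head_name \<sigma>)) (Const 1);;
     scan (\<not> \<sigma>) ''p'' ''x'';; scan (\<not> \<sigma>) ''x'' ''p''"

definition closure_prog :: prog where
  "closure_prog = While (Less (Reg ''headA'') (Reg ''A''))
     (process True;; While (Less (Reg ''headB'') (Reg ''B'')) (process False))"

definition bump :: "reg \<Rightarrow> prog" where
  "bump x = If (Equal (Reg ''e'') (Reg x)) (Add ''e'' (Reg ''e'') (Const 1)) skip"

definition start_round :: prog where
  "start_round =
     Load ''u'' ''src'' (Reg ''k'');; Load ''v'' ''dst'' (Reg ''k'');; Add ''k'' (Reg ''k'') (Const 1);;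
     Copy ''ok'' (Const 1);; Copy ''headA'' (Const 1);; Copy ''headB'' (Const 1);; Copy ''B'' (Const 0);;
     Store ''A'' (Const 0) (Reg ''u'');; Store ''A'' (Const 1) (Reg ''v'');; Copy ''A'' (Const 2);;
     Store ''markA'' (Reg ''u'') (Reg ''k'');; Store ''markA'' (Reg ''v'') (Reg ''k'')"

text \<open>
  If \<open>B\<close> stays empty, then \<open>u\<close> and \<open>v\<close> are twins, and any third vertex forms a pair with them;
  the three bumps produce one of 0, 1, 2.
\<close>

definition finish_round :: prog where
  "finish_round =
     If (Equal (Reg ''ok'') (Const 1))
      (If (Equal (Reg ''B'') (Const 0))
        (Copy ''e'' (Const 0);; bump ''u'';; bump ''v'';; bump ''u'';;
         Store ''B'' (Const 0) (Reg ''e'');; Copy ''B'' (Const 1))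
        skip;;
       Copy ''found'' (Const 1);; Copy ''k'' (Reg ''m''))
      skip"

definition round :: prog where
  "round = start_round;; closure_prog;; finish_round"

definition search :: prog where
  "search = Copy ''k'' (Const 0);; While (Less (Reg ''k'') (Reg ''m'')) round"

definition solve :: prog where
  "solve = If (Less (Reg ''n'') (Const 3)) skip (build;; search)"

section \<open>Correctness of the search\<close>

text \<open>Fixing the tables as functions separates the search from the way they are filled.
  \<open>off_bound\<close> keeps every table address within a memory word.\<close>

locale adjacency_data =
  fixes W n m :: nat and E :: "nat set set" and es :: "(nat \<times> nat) list"
    and N :: "nat \<Rightarrow> nat list" and off deg nbr adj :: "nat \<Rightarrow> nat"
  assumes graph: "simple_graph {..<n} E"
    and N: "\<And>v. set (N v) = {w. adjacent E v w}"
    and deg: "\<And>v. deg v = length (N v)"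
    and length_N: "\<And>v. length (N v) \<le> n"
    and nbr: "\<And>v i. i < length (N v) \<Longrightarrow> nbr (off v + i) = N v ! i"
    and adj: "\<And>v w. w < n \<Longrightarrow> adj (off v + w) = (if adjacent E v w then 1 else 0)"
    and off_bound: "\<And>v. off v + n \<le> W"
    and edge: "\<And>i. i < m \<Longrightarrow> {fst (es ! i), snd (es ! i)} \<in> E"
    and word: "n + 1 \<le> W" "m + 1 \<le> W" "3 \<le> n"
begin

section \<open>Memory representation of the graph and the chains\<close>

definition graph_in :: "state \<Rightarrow> bool" where
  "graph_in s \<longleftrightarrow> arrs s ''off'' = off \<and> arrs s ''deg'' = deg \<and> arrs s ''nbr'' = nbr \<and>
     arrs s ''adj'' = adj \<and> regs s ''n'' = n \<and> regs s ''m'' = m \<and>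
     (\<forall>i<m. arrs s ''src'' i = fst (es ! i) \<and> arrs s ''dst'' i = snd (es ! i))"

text \<open>The upper bound on all marks makes the next round number fresh everywhere.\<close>

definition chains_in :: "nat \<Rightarrow> chains \<times> bool \<Rightarrow> (bool \<Rightarrow> nat) \<Rightarrow> state \<Rightarrow> bool" where
  "chains_in k st H s \<longleftrightarrow> regs s ''k'' = k \<and> regs s ''ok'' = (if snd st then 1 else 0) \<and>
     (\<forall>\<sigma>. regs s (head_name \<sigma>) = H \<sigma> \<and> regs s (chain_name \<sigma>) = length (fst st \<sigma>) \<and>
        (\<forall>i<length (fst st \<sigma>). arrs s (chain_name \<sigma>) i = fst st \<sigma> ! i) \<and>
        (\<forall>y. arrs s (mark_name \<sigma>) y \<le> k \<and> (arrs s (mark_name \<sigma>) y = k \<longleftrightarrow> y \<in> set (fst st \<sigma>))))"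

definition agree :: "reg set \<Rightarrow> state \<Rightarrow> state \<Rightarrow> bool" where
  "agree R s s' \<longleftrightarrow> (\<forall>r\<in>R. regs s' r = regs s r)"

lemma graph_in_set_reg [simp]: "r \<notin> {''n'', ''m''} \<Longrightarrow> graph_in (set_reg r v s) \<longleftrightarrow> graph_in s"
  by (auto simp: graph_in_def)

lemma graph_in_set_arr [simp]:
  "a \<notin> {''off'', ''deg'', ''nbr'', ''adj'', ''src'', ''dst''} \<Longrightarrow> graph_in (set_arr a i v s) \<longleftrightarrow> graph_in s"
  by (auto simp: graph_in_def)

lemma agree_refl [simp]: "agree R s s"
  by (simp add: agree_def)

lemma adjacent_bound: "adjacent E x y \<Longrightarrow> x < n \<and> y < n"
  using graph by (auto simp: simple_graph_def adjacent_def)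

lemma off_le: "off v \<le> W"
  using off_bound[of v] by simp

lemma off_add_le: "w \<le> n \<Longrightarrow> off v + w \<le> W"
  using off_bound[of v] by simp

lemma push_wp:
  assumes "graph_in s" "chains_in k (L, ok) H s" "regs s ''y'' = y" "y < n" "k \<le> m"
    and L: "\<And>\<sigma>. distinct (L \<sigma>) \<and> set (L \<sigma>) \<subseteq> {..<n}"
  shows "wp W (push \<tau>) (\<lambda>t s'. t \<le> 16 \<and> graph_in s' \<and> chains_in k (push_chain E \<tau> y (L, ok)) H s' \<and>
    agree {''u'', ''v'', ''p'', ''x'', ''d'', ''o'', ''q'', ''i'', ''found''} s s') s"
proof -
  have mark: "arrs s (mark_name \<sigma>) z \<le> k" "arrs s (mark_name \<sigma>) z = k \<longleftrightarrow> z \<in> set (L \<sigma>)"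
    and chain: "regs s (chain_name \<sigma>) = length (L \<sigma>)" "i < length (L \<sigma>) \<Longrightarrow> arrs s (chain_name \<sigma>) i = L \<sigma> ! i"
    and ok: "regs s ''k'' = k" "regs s ''ok'' = (if ok then 1 else 0)" for \<sigma> z i
    using assms(2) by (auto simp: chains_in_def)
  have arr: "arrs s ''off'' = off" "arrs s ''adj'' = adj"
    using assms(1) by (auto simp: graph_in_def)
  have k: "k \<le> W" using word assms(5) by simp
  have mark_bound: "arrs s (mark_name \<sigma>) z \<le> W" for \<sigma> z
    using mark(1)[of \<sigma> z] k by simp
  consider "y \<in> set (L (\<not> \<tau>))" | "y \<notin> set (L (\<not> \<tau>))" "y \<in> set (L \<tau>)"
    | "y \<notin> set (L (\<not> \<tau>))" "y \<notin> set (L \<tau>)" by blast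
  then show ?thesis
  proof cases
    case 1
    then show ?thesis unfolding push_def using mark[of "\<not> \<tau>" y] k word assms(1,2,3)
      by (simp add: wp_simps ok mark_bound) (simp add: agree_def chains_in_def)
  next
    case 2
    then show ?thesis unfolding push_def using mark[of "\<not> \<tau>" y] mark[of "\<tau>" y] k word assms(1,2,3)
      by (simp add: wp_simps ok mark_bound) (simp add: agree_def chains_in_def)
  next
    case 3
    \<comment> \<open>A repetition-free chain together with the new vertex still fits among
      \<open>n\<close> vertices, so the incremented length fits into a word.\<close>
    have "length (L \<tau>) + 1 \<le> n"
    proof -
      have "card (insert y (set (L \<tau>))) \<le> card {..<n}"
        using L[of \<tau>] assms(4) by (intro card_mono) auto
      then show ?thesis using 3 L[of \<tau>] by (simp add: distinct_card)
    qed
    then have len': "length (L \<tau>) + 1 \<le> W" using word by simp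
    have yW: "y \<le> W" using assms(4) word by simp
    have marked: "\<forall>z. (if z = y then k else arrs s (mark_name \<tau>) z) \<le> k \<and>
        ((if z = y then k else arrs s (mark_name \<tau>) z) = k \<longleftrightarrow> z = y \<or> z \<in> set (L \<tau>))"
      using mark by auto
    show ?thesis
    proof (cases "L \<tau> = []")
      case True
      then show ?thesis unfolding push_def
        using 3 mark(2)[of "\<not> \<tau>" y] mark(2)[of "\<tau>" y] k yW len' word assms(1,3) chain(1)[of \<tau>]
        apply (simp add: wp_simps ok mark_bound)
        using assms(2) marked
        apply (simp add: agree_def chains_in_def)
        done
    next
      case False
      have l: "arrs s (chain_name \<tau>) (length (L \<tau>) - Suc 0) = last (L \<tau>)"
        using chain(2)[of "length (L \<tau>) - 1" \<tau>] False by (simp add: last_conv_nth)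
      have lW: "last (L \<tau>) \<le> W" using L[of \<tau>] word(1) last_in_set[OF False]
          by (meson add_leD1 lessThan_iff less_imp_le order_trans subsetD)
      have ad: "adj (off (last (L \<tau>)) + y) = (if adjacent E (last (L \<tau>)) y then 1 else 0)"
        using adj assms(4) by blast
      show ?thesis unfolding push_def
        using 3 False mark(2)[of "\<not> \<tau>" y] mark(2)[of "\<tau>" y] k yW len' word assms(1,3,4) chain(1)[of \<tau>] ad
        apply (simp add: wp_simps ok mark_bound l lW arr off_le off_add_le)
        using assms(2) marked
        apply (simp add: agree_def chains_in_def nth_append)
        done
    qed
  qed
qed

lemma agree_set_reg [simp]: "r \<notin> R \<Longrightarrow> agree R s (set_reg r v s') \<longleftrightarrow> agree R s s'"
  by (auto simp: agree_def)

lemma agree_set_arr [simp]: "agree R s (set_arr a i v s') \<longleftrightarrow> agree R s s'"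
  by (auto simp: agree_def)

lemma chains_in_set_reg [simp]:
  "r \<notin> {''k'', ''ok'', ''A'', ''B'', ''headA'', ''headB''} \<Longrightarrow> chains_in k st H (set_reg r v s) \<longleftrightarrow>
      chains_in k st H s"
  by (auto simp: chains_in_def)

lemma chain_inv_length:
  assumes "chain_inv n E u v st" shows "length (fst st \<sigma>) \<le> n"
proof -
  have "card (set (fst st \<sigma>)) \<le> card {..<n}"
    using assms by (intro card_mono) (auto simp: chain_inv_def)
  then show ?thesis using assms by (auto simp: chain_inv_def distinct_card)
qed

lemma scan_wp:
  assumes s: "graph_in s" "chains_in k st H s" and k: "k \<le> m" and inv: "chain_inv n E u v st"
    and px: "p \<in> {''p'', ''x''}" "x \<in> {''p'', ''x''}" "regs s p = P" "regs s x = X"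
    and mem: "P \<in> set (fst st (\<not> \<tau>))" "X \<in> set (fst st (\<not> \<tau>))"
  shows "wp W (scan \<tau> p x) (\<lambda>t s'. t \<le> 30 * length (N P) + 10 \<and> graph_in s' \<and>
    chains_in k (fold (scan_step E \<tau> X) (N P) st) H s' \<and>
    agree {''u'', ''v'', ''p'', ''x'', ''found''} s s') s"
proof -
  let ?R = "{''u'', ''v'', ''p'', ''x'', ''found''}"
  let ?st = "\<lambda>i. fold (scan_step E \<tau> X) (take i (N P)) st"
  \<comment> \<open>The ghost state is the loop index alone: the chains after \<open>i\<close>
    iterations are the fold over the first \<open>i\<close> neighbours.\<close>
  define I where "I i s' \<longleftrightarrow> i \<le> length (N P) \<and> graph_in s' \<and> chains_in k (?st i) H s' \<and> agree ?R s s' \<and>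
    regs s' ''i'' = i \<and> regs s' ''d'' = length (N P) \<and> regs s' ''o'' = off P \<and> regs s' ''q'' = off X" for i s'
  have inv': "chain_inv n E u v (?st i)" for i
    by (rule chain_inv_fold_scan[OF inv graph mem]) (use N in \<open>auto dest: in_set_takeD\<close>)
  have body: "wp W (scan_body \<tau> x) (\<lambda>t s''. \<exists>j. I j s'' \<and> 1 + t + 30 * (length (N P) - j) \<le>
      30 * (length (N P) - i)) s'"
    if "I i s'" "holds (Less (Reg ''i'') (Reg ''d'')) s'" for i s'
  proof -
    define y where "y = N P ! i"
    have i: "i < length (N P)" using that by (simp add: I_def)
    have nb: "nbr (off P + i) = y" using nbr[OF i] by (simp add: y_def)
    have "y \<in> set (N P)" using i by (simp add: y_def)
    then have y: "y < n" using N adjacent_bound by blast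
    have i1: "i \<le> n" "Suc i \<le> W" using i length_N[of P] word by auto
    have x: "regs s' x = X" using that(1) px by (auto simp: I_def agree_def)
    have step: "?st (Suc i) = scan_step E \<tau> X y (?st i)"
      using i by (simp add: take_Suc_conv_app_nth y_def)
    obtain L ok where Lok: "?st i = (L, ok)" by (cases "?st i")
    have s': "graph_in s'" "chains_in k (?st i) H s'" "agree ?R s s'" "regs s' ''i'' = i"
      "regs s' ''d'' = length (N P)" "regs s' ''o'' = off P" "regs s' ''q'' = off X"
      "arrs s' ''nbr'' = nbr" "arrs s' ''adj'' = adj"
      using that(1) by (auto simp: I_def graph_in_def)
    have fin: "\<exists>j. I j s'' \<and> Suc (t + 30 * (length (N P) - j)) \<le> 30 * (length (N P) - i)"
      if "t \<le> 29" "I (Suc i) s''" for t s''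
      using that i by (intro exI[of _ "Suc i"]) auto
    have x': "x \<noteq> ''y''" "x \<noteq> ''e''" "x \<noteq> ''i''" using px by auto
    show ?thesis
    proof (cases "y = X \<or> adjacent E X y")
      case True
      then have "?st (Suc i) = ?st i" using step by (simp add: scan_step_def)
      then show ?thesis using True y i1 x x' nb s' adj[OF y, of X] word i
        by (simp add: scan_body_def wp_simps off_add_le) (intro conjI impI fin; simp add: I_def)
    next
      case False
      have L: "distinct (L \<sigma>) \<and> set (L \<sigma>) \<subseteq> {..<n}" for \<sigma>
        using inv'[of i] Lok by (auto simp: chain_inv_def)
      show ?thesis using False y i1 x x' nb s' adj[OF y, of X] word i
        apply (simp add: scan_body_def wp_simps off_add_le)
        apply (rule wp_mono, rule push_wp[where k=k and H=H and L=L and ok=ok and y=y])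
        apply (simp_all add: k L Lok del: push_chain.simps)
        \<comment> \<open>Seven units of \<open>scan_body\<close> precede \<open>push\<close>; with
          at most 16 for \<open>push\<close> this stays within the 29 allowed per neighbour.\<close>
        subgoal for t s2
          using fin[of "t + 7" s2] by (simp add: I_def step Lok scan_step_def agree_def del: push_chain.simps)
        done
    qed
  qed
  have fin: "agree ?R s s' \<Longrightarrow> I 0 (set_reg ''i'' 0 (set_reg ''q'' (off X) (set_reg ''o'' (off P) (set_reg
      ''d'' (length (N P)) s))))" for s'
    using s by (simp add: I_def)
  have arr: "arrs s ''off'' = off" "arrs s ''deg'' = deg" using s by (auto simp: graph_in_def)
  have lW: "length (N P) \<le> W" using length_N[of P] word by simp
  have p': "p \<noteq> ''d''" "p \<noteq> ''o''" "x \<noteq> ''d''" "x \<noteq> ''o''" using px by auto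
  show ?thesis unfolding scan_def using px(3,4) arr lW p' word
    apply (simp add: wp_simps off_le deg)
    apply (rule wp_mono, rule wp_While[where I=I and \<phi>="\<lambda>i. 30 * (length (N P) - i)" and g=0])
    apply (rule body, assumption+)
    apply (rule fin, rule agree_refl)
    apply (auto simp: I_def)
    done
qed

section \<open>Amortised cost of the closure\<close>

text \<open>Heads start at 1 because the first member has no predecessor; \<open>max 1\<close>
  admits this value while chain \<open>False\<close> is still empty.\<close>

definition closure_state :: "nat \<Rightarrow> nat \<Rightarrow> (chains \<times> bool) \<times> (bool \<Rightarrow> nat) \<Rightarrow> bool" where
  "closure_state u v g \<longleftrightarrow> chain_inv n E u v (fst g) \<and> closed_upto E (fst g) (snd g) \<and>
     (\<forall>\<sigma>. 1 \<le> snd g \<sigma> \<and> snd g \<sigma> \<le> max 1 (length (fst (fst g) \<sigma>)))"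

definition size_E :: nat where
  "size_E = (\<Sum>v<n. length (N v))"

text \<open>\<open>3 * size_E\<close> is the largest possible total work. The price of 100 per unit
  covers 30 per scanned neighbour and, through the extra 1 of each pair, all fixed costs.\<close>

definition potential :: "(chains \<times> bool) \<times> (bool \<Rightarrow> nat) \<Rightarrow> nat" where
  "potential g = 100 * (3 * size_E -
     (scan_work N (fst (fst g)) (snd g) True + scan_work N (fst (fst g)) (snd g) False))"

definition closure_at :: "nat \<Rightarrow> nat \<Rightarrow> nat \<Rightarrow> state \<Rightarrow> (chains \<times> bool) \<times> (bool \<Rightarrow> nat) \<Rightarrow> state \<Rightarrow> bool" where
  "closure_at k u v s0 g s \<longleftrightarrow> closure_state u v g \<and> graph_in s \<and> chains_in k (fst g) (snd g) s \<and>
     agree {''u'', ''v'', ''found''} s0 s"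

lemma process_wp:
  assumes s: "closure_at k u v s0 (st, H) s" and k: "k \<le> m" and lt: "H \<sigma> < length (fst st \<sigma>)"
  shows "wp W (process \<sigma>) (\<lambda>t s'. \<exists>g'. closure_at k u v s0 g' s' \<and>
      t + 10 + potential g' \<le> potential (st, H)) s"
proof -
  obtain L ok where st: "st = (L, ok)" by (cases st)
  define P where "P = L \<sigma> ! (H \<sigma> - 1)"
  define X where "X = L \<sigma> ! H \<sigma>"
  let ?H = "H(\<sigma> := Suc (H \<sigma>))"
  let ?st1 = "fold (scan_step E (\<not> \<sigma>) X) (N P) st"
  let ?st2 = "expand E N \<sigma> P X st"
  have inv: "chain_inv n E u v st" and closed: "closed_upto E st H"
    and H: "\<And>\<tau>. 1 \<le> H \<tau>" "\<And>\<tau>. H \<tau> \<le> max 1 (length (L \<tau>))"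
    and gr: "graph_in s" and ch: "chains_in k st H s" and ag: "agree {''u'', ''v'', ''found''} s0 s"
    using s by (auto simp: closure_at_def closure_state_def st)
  have lt': "H \<sigma> < length (L \<sigma>)" "H \<sigma> - 1 < length (L \<sigma>)" using lt by (auto simp: st)
  have mem: "P \<in> set (L \<sigma>)" "X \<in> set (L \<sigma>)" using lt' by (auto simp: P_def X_def)
  have PX: "P < n" "X < n" using inv mem by (auto simp: chain_inv_def st)
  have regs: "regs s (head_name \<sigma>) = H \<sigma>" "arrs s (chain_name \<sigma>) (H \<sigma> - 1) = P"
      "arrs s (chain_name \<sigma>) (H \<sigma>) = X"
    using ch lt' by (auto simp: chains_in_def st P_def X_def)
  have bound: "Suc (H \<sigma>) \<le> W" using chain_inv_length[OF inv, of \<sigma>] lt word by simp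
  have ext: "extends st ?st2" by (rule extends_expand)
  obtain L2 ok2 where st2: "?st2 = (L2, ok2)" by (cases ?st2)
  have inv1: "chain_inv n E u v ?st1"
    by (rule chain_inv_fold_scan[OF inv graph, of P]) (use mem N st in auto)
  have inv2: "chain_inv n E u v ?st2" by (rule chain_inv_expand[OF inv graph _ _ N]) (use mem st in auto)
  have H2: "?H \<tau> \<le> max 1 (length (L2 \<tau>))" for \<tau>
    using extends_length[OF ext, of \<tau>, unfolded st2] H(2)[of \<tau>] lt' by (cases "\<tau> = \<sigma>") (simp_all add: st)
  have closed2: "closed_upto E ?st2 ?H"
    using closed_upto_expand[OF inv closed H(1) lt _ N] H(2) by (simp add: P_def X_def st)
  have "closure_state u v (?st2, ?H)"
    using inv2 closed2 H2 H(1) by (simp add: closure_state_def st2)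
  then have good: "closure_at k u v s0 (?st2, ?H) s'" if "graph_in s'" "chains_in k ?st2 ?H s'" "agree
      {''u'', ''v'', ''found''} s0 s'" for s'
    using that by (simp add: closure_at_def)
  have work: "scan_work N L2 ?H \<tau> = scan_work N L H \<tau> + (if \<tau> = \<sigma> then length (N P) + length (N X) + 1
      else 0)" for \<tau>
    unfolding P_def X_def by (rule scan_work_step[OF ext[unfolded st2, unfolded st]]) (rule H lt')+
  \<comment> \<open>This keeps the truncated subtraction in \<open>potential\<close> exact, so that
    the step really lowers it by the full price.\<close>
  have le: "scan_work N L2 ?H True + scan_work N L2 ?H False \<le> 3 * size_E"
    unfolding size_E_def using inv2 H2 N by (intro scan_work_le) (auto simp: st2)
  have pot: "100 * (length (N P) + length (N X) + 1) + potential (?st2, ?H) \<le> potential (st, H)"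
    unfolding st2 using le work[of True] work[of False] by (cases \<sigma>) (simp_all add: potential_def st)
  let ?s1 = "set_reg (head_name \<sigma>) (Suc (H \<sigma>)) (set_reg ''x'' X (set_reg ''p'' P
      (set_reg ''e'' (H \<sigma> - 1) s)))"
  have s1: "graph_in ?s1" "chains_in k st ?H ?s1" "regs ?s1 ''p'' = P" "regs ?s1 ''x'' = X"
    using gr ch by (auto simp: chains_in_def)
  have ag1: "agree {''u'', ''v'', ''found''} s0 ?s1" using ag by simp
  have mem1: "P \<in> set (fst ?st1 \<sigma>)" "X \<in> set (fst ?st1 \<sigma>)"
    using mem extends_set[OF extends_fold_scan, of st \<sigma> E "\<not> \<sigma>" X "N P"] by (auto simp: st)
  have second: "wp W (scan (\<not> \<sigma>) ''x'' ''p'') (\<lambda>t s'. t \<le> 30 * length (N X) + 10 \<and> graph_in s' \<and>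
      chains_in k ?st2 ?H s' \<and> agree {''u'', ''v'', ''p'', ''x'', ''found''} s2 s') s2"
    if "graph_in s2" "chains_in k ?st1 ?H s2" "regs s2 ''p'' = P" "regs s2 ''x'' = X" for s2
    unfolding expand_def
    by (rule scan_wp[OF that(1,2) k inv1]) (use that mem1 in simp_all)
  have first: "wp W (scan (\<not> \<sigma>) ''p'' ''x'') (\<lambda>t s'. t \<le> 30 * length (N P) + 10 \<and> graph_in s' \<and>
      chains_in k ?st1 ?H s' \<and> agree {''u'', ''v'', ''p'', ''x'', ''found''} ?s1 s') ?s1"
    by (rule scan_wp[OF s1(1,2) k inv]) (use s1 mem st in auto)
  have both: "wp W (scan (\<not> \<sigma>) ''p'' ''x'';; scan (\<not> \<sigma>) ''x'' ''p'')
      (\<lambda>t s'. t \<le> 30 * length (N P) + 30 * length (N X) + 20 \<and> closure_at k u v s0 (?st2, ?H) s') ?s1"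
    unfolding wp_Seq
  proof (rule wp_mono[OF first])
    fix t s2 assume 2: "t \<le> 30 * length (N P) + 10 \<and> graph_in s2 \<and>
      chains_in k ?st1 ?H s2 \<and> agree {''u'', ''v'', ''p'', ''x'', ''found''} ?s1 s2"
    then have "regs s2 ''p'' = P" "regs s2 ''x'' = X" and ag2: "agree {''u'', ''v'', ''found''} s0 s2"
      using s1 ag1 by (auto simp: agree_def)
    with 2 have w: "wp W (scan (\<not> \<sigma>) ''x'' ''p'') (\<lambda>t s'. t \<le> 30 * length (N X) + 10 \<and> graph_in s' \<and>
      chains_in k ?st2 ?H s' \<and> agree {''u'', ''v'', ''p'', ''x'', ''found''} s2 s') s2"
      by (intro second) auto
    show "wp W (scan (\<not> \<sigma>) ''x'' ''p'') (\<lambda>t' s'. t + t' \<le> 30 * length (N P) + 30 * length (N X) + 20 \<and>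
      closure_at k u v s0 (?st2, ?H) s') s2"
      by (rule wp_mono[OF w], intro conjI good) (use 2 ag2 in \<open>auto simp: agree_def\<close>)
  qed
  \<comment> \<open>The four successors are the instructions before the scans; the surplus 10 is
    left for the loop tests of \<open>closure_prog\<close>.\<close>
  have final: "wp W (scan (\<not> \<sigma>) ''p'' ''x'';; scan (\<not> \<sigma>) ''x'' ''p'')
      (\<lambda>t s'. \<exists>g'. closure_at k u v s0 g' s' \<and> Suc (Suc (Suc (Suc (t + 10 + potential g')))) \<le> potential
          (st, H)) ?s1"
  proof (rule wp_mono[OF both], elim conjE)
    fix t s' assume "t \<le> 30 * length (N P) + 30 * length (N X) + 20" "closure_at k u v s0 (?st2, ?H) s'"
    then show "\<exists>g'. closure_at k u v s0 g' s' \<and> Suc (Suc (Suc (Suc (t + 10 + potential g')))) \<le>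
        potential (st, H)"
      using pot by (intro exI[of _ "(?st2, ?H)"] conjI) simp_all
  qed
  have WPX: "P \<le> W" "X \<le> W" "H \<sigma> \<le> W" "H \<sigma> - 1 \<le> W" using PX word bound by auto
  show ?thesis unfolding process_def
    using final bound WPX regs by (simp add: wp_simps add.assoc)
qed

text \<open>Both loops draw on one potential, so nesting does not multiply their costs. The outer
  invariant says that side \<open>False\<close> is exhausted, which the inner loop restores after
  each step on side \<open>True\<close>.\<close>

lemma closure_wp:
  assumes s: "closure_at k u v s0 (st, H) s" and k: "k \<le> m" and B: "length (fst st False) \<le> H False"
  shows "wp W closure_prog (\<lambda>t s'. t \<le> 300 * size_E + 1 \<and> (\<exists>g. closure_at k u v s0 g s' \<and>
    (\<forall>\<sigma>. length (fst (fst g) \<sigma>) \<le> snd g \<sigma>))) s"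
proof -
  have names: "regs s' ''headA'' = snd g True" "regs s' ''A'' = length (fst (fst g) True)"
    "regs s' ''headB'' = snd g False" "regs s' ''B'' = length (fst (fst g) False)"
    if "closure_at k u v s0 g s'" for g s'
    using that by (auto simp: closure_at_def chains_in_def head_name_def chain_name_def all_bool_eq)
  have proc: "wp W (process \<sigma>) (\<lambda>t s''. \<exists>g'. closure_at k u v s0 g' s'' \<and>
      t + 10 + potential g' \<le> potential g) s'"
    if "closure_at k u v s0 g s'" "snd g \<sigma> < length (fst (fst g) \<sigma>)" for g s' \<sigma>
    using process_wp[of k u v s0 "fst g" "snd g" s' \<sigma>] that k by simp
  have inner: "wp W (While (Less (Reg ''headB'') (Reg ''B'')) (process False))
      (\<lambda>t s''. \<exists>g'. closure_at k u v s0 g' s'' \<and> \<not> holds (Less (Reg ''headB'') (Reg ''B'')) s'' \<and>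
        t + potential g' \<le> 1 + potential g) s'"
    if "closure_at k u v s0 g s'" for g s'
  proof (rule wp_While[where I="closure_at k u v s0"])
    fix g s' assume g: "closure_at k u v s0 g s'" "holds (Less (Reg ''headB'') (Reg ''B'')) s'"
    show "wp W (process False) (\<lambda>t s''. \<exists>g'. closure_at k u v s0 g' s'' \<and>
        1 + t + potential g' \<le> potential g) s'"
    proof (rule wp_mono[OF proc[OF g(1)]])
      show "snd g False < length (fst (fst g) False)" using g(2) names[OF g(1)] by simp
    next
      fix t s'' assume "\<exists>g'. closure_at k u v s0 g' s'' \<and> t + 10 + potential g' \<le> potential g"
      then obtain g' where "closure_at k u v s0 g' s''" "t + 10 + potential g' \<le> potential g" by blast
      then show "\<exists>g'. closure_at k u v s0 g' s'' \<and> 1 + t + potential g' \<le> potential g"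
        by (intro exI[of _ g'] conjI) simp_all
    qed
  qed fact
  let ?J = "\<lambda>g s'. closure_at k u v s0 g s' \<and> length (fst (fst g) False) \<le> snd g False"
  let ?Q = "\<lambda>t s'. \<exists>g'. ?J g' s' \<and> \<not> holds (Less (Reg ''headA'') (Reg ''A'')) s' \<and>
      t + potential g' \<le> 1 + potential (st, H)"
  have "wp W closure_prog ?Q s"
    unfolding closure_prog_def
  proof (rule wp_While[where I="?J"])
    fix g s' assume J: "?J g s'" "holds (Less (Reg ''headA'') (Reg ''A'')) s'"
    have 1: "wp W (process True) (\<lambda>t s''. \<exists>g'. closure_at k u v s0 g' s'' \<and>
        t + 10 + potential g' \<le> potential g) s'"
      by (rule proc) (use J names[OF J(1)[THEN conjunct1]] in simp_all)
    show "wp W (process True;; While (Less (Reg ''headB'') (Reg ''B'')) (process False))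
        (\<lambda>t s'. \<exists>g'. ?J g' s' \<and> 1 + t + potential g' \<le> potential g) s'"
      unfolding wp_Seq
    proof (rule wp_mono[OF 1], elim exE conjE)
      fix t s2 g2 assume g2: "closure_at k u v s0 g2 s2" "t + 10 + potential g2 \<le> potential g"
      show "wp W (While (Less (Reg ''headB'') (Reg ''B'')) (process False))
        (\<lambda>t'  s'. \<exists>g'. ?J g' s' \<and> 1 + (t + t') + potential g' \<le> potential g) s2"
      proof (rule wp_mono[OF inner[OF g2(1)]], elim exE conjE)
        fix t' s3 g3 assume g3: "closure_at k u v s0 g3 s3" "\<not> holds (Less (Reg ''headB'') (Reg ''B'')) s3"
          "t' + potential g3 \<le> 1 + potential g2"
        then have "length (fst (fst g3) False) \<le> snd g3 False" using names[OF g3(1)] by simp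
        then show "\<exists>g'. ?J g' s3 \<and> 1 + (t + t') + potential g' \<le> potential g"
          using g2(2) g3 by (intro exI[of _ g3] conjI) simp_all
      qed
    qed
  qed (use s B in simp)
  then show ?thesis
  proof (rule wp_mono, elim exE conjE)
    fix t s' g assume g: "closure_at k u v s0 g s'" "length (fst (fst g) False) \<le> snd g False"
      "\<not> holds (Less (Reg ''headA'') (Reg ''A'')) s'" "t + potential g \<le> 1 + potential (st, H)"
    have "potential (st, H) \<le> 300 * size_E" by (simp add: potential_def)
    then show "t \<le> 300 * size_E + 1 \<and> (\<exists>g. closure_at k u v s0 g s' \<and> (\<forall>\<sigma>. length (fst (fst g) \<sigma>) \<le> snd g \<sigma>))"
      using g names[OF g(1)] by (intro conjI exI[of _ g]) (simp_all add: all_bool_eq)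
  qed
qed

text \<open>Both branches take two units. In \<open>finish_round\<close> the vertex \<open>u\<close>
  is bumped a second time because stepping past \<open>v\<close> may land on
  \<open>u\<close>.\<close>

lemma wp_bump: "regs s ''e'' + 1 \<le> W \<Longrightarrow> wp W (bump x) Q s \<longleftrightarrow>
    (if regs s ''e'' = regs s x then Q 2 (set_reg ''e'' (regs s ''e'' + 1) s) else Q 2 (set_reg ''z'' 0 s))"
  by (simp add: bump_def wp_simps numeral_2_eq_2)

section \<open>The search over all edges\<close>

text \<open>A success jumps to \<open>k = m\<close> and thereby ends the loop, so a round always
  starts with no pair found.\<close>

definition search_inv :: "nat \<Rightarrow> state \<Rightarrow> bool" where
  "search_inv k s \<longleftrightarrow> graph_in s \<and> regs s ''k'' = k \<and> k \<le> m \<and> (\<forall>\<sigma> y. arrs s (mark_name \<sigma>) y \<le> k) \<and>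
     (if regs s ''found'' = 0
      then \<forall>i<k. \<forall>X. pair_on n E X \<longrightarrow> \<not> (fst (es ! i) \<in> X True \<and> snd (es ! i) \<in> X True)
      else k = m \<and> homogeneous_pair_of_cliques {..<n} E (out_A s) (out_B s))"

lemma nth_image_eq: "(\<And>i. i < length xs \<Longrightarrow> f i = xs ! i) \<Longrightarrow> {f i |i. i < length xs} = set xs"
  by (force simp: in_set_conv_nth)

text \<open>The constant 40 covers the 12 units of \<open>start_round\<close>, at most 20 of
  \<open>finish_round\<close>, and the loop tests.\<close>

lemma round_wp:
  assumes s: "search_inv k s" and k: "k < m"
  shows "wp W round (\<lambda>t s'. \<exists>k'. search_inv k' s' \<and> 1 + t + (300 * size_E + 40) * (m - k') \<le>
      (300 * size_E + 40) * (m - k)) s"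
proof -
  define u where "u = fst (es ! k)"
  define v where "v = snd (es ! k)"
  have uv: "{u, v} \<in> E" using edge[OF k] by (simp add: u_def v_def)
  then have uvn: "u < n" "v < n" "u \<noteq> v" using graph by (auto simp: simple_graph_def)
  have found: "regs s ''found'' = 0" using s k by (simp add: search_inv_def split: if_splits)
  have s': "graph_in s" "regs s ''k'' = k" "\<And>\<sigma> y. arrs s (mark_name \<sigma>) y \<le> k"
    "arrs s ''src'' k = u" "arrs s ''dst'' k = v" "regs s ''m'' = m"
    using s k by (auto simp: search_inv_def graph_in_def u_def v_def)
  have prev: "\<not> (fst (es ! i) \<in> X True \<and> snd (es ! i) \<in> X True)" if "i < k" "pair_on n E X" for i X
    using s found that by (auto simp: search_inv_def)
  have W: "u \<le> W" "v \<le> W" "2 \<le> W" "Suc k \<le> W" "1 \<le> W" using uvn word k by auto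
  let ?s1 = "set_arr ''markA'' v (Suc k) (set_arr ''markA'' u (Suc k) (set_reg ''A'' 2 (set_arr ''A'' 1 v
      (set_arr ''A'' 0 u (set_reg ''B'' 0 (set_reg ''headB'' 1 (set_reg ''headA'' 1 (set_reg ''ok'' 1 (set_reg ''k'' (Suc k)
         (set_reg ''v'' v (set_reg ''u'' u s)))))))))))"
  let ?g = "((\<lambda>\<sigma>. if \<sigma> then [u, v] else [], True), \<lambda>_::bool. 1::nat)"
  \<comment> \<open>All marks are at most \<open>k\<close>, so after the two stores exactly
    \<open>u\<close> and \<open>v\<close> carry the number of the new round.\<close>
  have marks: "arrs s ''markA'' y \<le> Suc k" "arrs s ''markA'' y \<noteq> Suc k" "arrs s ''markB'' y \<le> Suc k"
      "arrs s ''markB'' y \<noteq> Suc k" for y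
    using s'(3)[of True y] s'(3)[of False y] by (auto simp: mark_name_def)
  have "chains_in (Suc k) (fst ?g) (snd ?g) ?s1"
    using marks by (auto simp: chains_in_def all_bool_eq head_name_def chain_name_def mark_name_def
        nth_Cons split: nat.split)
  moreover have "closure_state u v ?g"
    using chain_inv_init[OF graph uv] by (auto simp: closure_state_def closed_upto_def)
  ultimately have "closure_at (Suc k) u v ?s1 ?g ?s1" using s' by (simp add: closure_at_def)
  then have close: "wp W closure_prog (\<lambda>t s'. t \<le> 300 * size_E + 1 \<and> (\<exists>g. closure_at (Suc k) u v ?s1 g s' \<and>
    (\<forall>\<sigma>. length (fst (fst g) \<sigma>) \<le> snd g \<sigma>))) ?s1"
    by (rule closure_wp) (use k in auto)
  have post: "wp W finish_round (\<lambda>t s'. t \<le> 20 \<and> (\<exists>k'. Suc k \<le> k' \<and> search_inv k' s')) s2"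
    if c: "closure_at (Suc k) u v ?s1 g s2" and len: "\<forall>\<sigma>. length (fst (fst g) \<sigma>) \<le> snd g \<sigma>" for g s2
  proof -
    obtain L ok H where g: "g = ((L, ok), H)" by (metis surj_pair)
    have inv: "chain_inv n E u v (L, ok)" and closed: "closed_upto E (L, ok) H" and gr: "graph_in s2"
      and ch: "chains_in (Suc k) (L, ok) H s2" and ag: "agree {''u'', ''v'', ''found''} ?s1 s2"
      using c by (auto simp: closure_at_def closure_state_def g)
    have r: "regs s2 ''u'' = u" "regs s2 ''v'' = v" "regs s2 ''found'' = 0" "regs s2 ''k'' = Suc k"
      "regs s2 ''ok'' = (if ok then 1 else 0)" "regs s2 ''m'' = m"
      "regs s2 ''A'' = length (L True)" "regs s2 ''B'' = length (L False)"
      using ag ch gr found by (auto simp: agree_def chains_in_def graph_in_def chain_name_def all_bool_eq)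
    have AB: "i < length (L True) \<Longrightarrow> arrs s2 ''A'' i = L True ! i" "i < length (L False) \<Longrightarrow>
        arrs s2 ''B'' i = L False ! i" for i
      using ch by (auto simp: chains_in_def chain_name_def all_bool_eq)
    have mk: "arrs s2 (mark_name \<sigma>) y \<le> Suc k" for \<sigma> y using ch by (auto simp: chains_in_def)
    have mkm: "arrs s2 (mark_name \<sigma>) y \<le> m" for \<sigma> y using mk[of \<sigma> y] k by simp
    show ?thesis
    proof (cases ok)
      case False
      have "\<not> (u \<in> X True \<and> v \<in> X True)" if "pair_on n E X" for X
        using inv False that by (auto simp: chain_inv_def)
      then have "search_inv (Suc k) (set_reg ''z'' 0 s2)"
        using gr r k mk prev by (auto simp: search_inv_def less_Suc_eq u_def v_def)
      then show ?thesis using False r by (auto simp: finish_round_def wp_simps)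
    next
      case True
      have hp: "homogeneous_pair_of_cliques {..<n} E (set (L True)) (if L False = [] then {w} else set
          (L False))"
        if "w < n" "w \<noteq> u" "w \<noteq> v" for w
        using closed_homogeneous_pair[of n E u v L H w] inv closed len that by (simp add: True g)
      have goal_inv: "search_inv m s3"
        if "graph_in s3" "regs s3 ''k'' = m" "\<And>\<sigma> y. arrs s3 (mark_name \<sigma>) y = arrs s2 (mark_name \<sigma>) y"
          "regs s3 ''found'' = 1" "homogeneous_pair_of_cliques {..<n} E (out_A s3) (out_B s3)" for s3
        using that mkm by (simp add: search_inv_def)
      have oA: "{arrs s2 ''A'' i |i. i < length (L True)} = set (L True)"
        and oB: "{arrs s2 ''B'' i |i. i < length (L False)} = set (L False)"
        using AB by (auto intro!: nth_image_eq)
      show ?thesis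
      proof (cases "L False = []")
        case False
        \<comment> \<open>\<open>hp\<close> speaks of a third vertex in both cases; one of three
          candidates avoids \<open>u\<close> and \<open>v\<close>, and \<open>3 \<le> n\<close>
          makes it a vertex.\<close>
        have "\<exists>w\<in>{0, 1, 2}. w \<noteq> u \<and> w \<noteq> v" by auto
        then obtain w where w: "w \<in> {0, 1, 2}" "w \<noteq> u" "w \<noteq> v" by blast
        then have "w < n" using word by auto
        with w(2,3) have "homogeneous_pair_of_cliques {..<n} E (set (L True)) (set (L False))"
          using hp[of w] False by auto
        then show ?thesis using True False r W word k gr
          by (simp add: finish_round_def wp_simps)
             (intro exI[of _ m] conjI goal_inv; simp add: out_A_def out_B_def oA oB)
      next
        case B: True
        have hp': "w < n \<Longrightarrow> w \<noteq> u \<Longrightarrow> w \<noteq> v \<Longrightarrow> homogeneous_pair_of_cliques {..<n} E (set (L True)) {w}" for w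
          using hp[of w] B by simp
        show ?thesis using True B r W word k gr uvn
          apply (simp add: finish_round_def wp_simps wp_bump)
          apply (intro conjI impI exI[of _ m] goal_inv; simp add: out_A_def out_B_def oA hp')
          done
      qed
    qed
  qed
  have start: "wp W start_round (\<lambda>t s'. t = 12 \<and> s' = ?s1) s"
    using W s' by (simp add: start_round_def wp_simps)
  \<comment> \<open>The counter may jump by more than one, as success sets it to \<open>m\<close>,
    but the budget always falls by at least \<open>C\<close>.\<close>
  have dec: "1 + t + C * (m - k') \<le> C * (m - k)" if "Suc k \<le> k'" "Suc t \<le> C" for t k' C :: nat
  proof -
    have "C * (m - k') + C \<le> C * (m - k)"
      using that(1) k mult_le_mono2[of "m - k' + 1" "m - k" C] by (simp add: algebra_simps)
    then show ?thesis using that(2) by simp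
  qed
  show ?thesis unfolding round_def wp_Seq
  proof (rule wp_mono[OF start], elim conjE, hypsubst, rule wp_mono[OF close], elim conjE exE)
    fix t s2 g assume 1: "t \<le> 300 * size_E + 1" "closure_at (Suc k) u v ?s1 g s2"
      "\<forall>\<sigma>. length (fst (fst g) \<sigma>) \<le> snd g \<sigma>"
    show "wp W finish_round (\<lambda>t' s'. \<exists>k'. search_inv k' s' \<and> 1 + (12 + (t + t')) +
        (300 * size_E + 40) * (m - k') \<le> (300 * size_E + 40) * (m - k)) s2"
    proof (rule wp_mono[OF post[OF 1(2,3)]], elim conjE exE)
      fix t' :: nat and s3 k' assume "t' \<le> 20" "Suc k \<le> k'" "search_inv k' s3"
      then show "\<exists>k'. search_inv k' s3 \<and> 1 + (12 + (t + t')) +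
          (300 * size_E + 40) * (m - k') \<le> (300 * size_E + 40) * (m - k)"
        using 1(1) by (intro exI[of _ k'] conjI dec) auto
    qed
  qed
qed

lemma search_wp:
  assumes s: "graph_in s" "\<And>\<sigma> y. arrs s (mark_name \<sigma>) y = 0" "regs s ''found'' = 0"
    and cover: "\<And>e. e \<in> E \<Longrightarrow> \<exists>i<m. e = {fst (es ! i), snd (es ! i)}"
  shows "wp W search (\<lambda>t s'. t \<le> (300 * size_E + 40) * m + 2 \<and> correct_answer {..<n} E s') s"
proof -
  have "wp W (While (Less (Reg ''k'') (Reg ''m'')) round) (\<lambda>t s'. \<exists>k'. search_inv k' s' \<and>
      \<not> holds (Less (Reg ''k'') (Reg ''m'')) s' \<and>
      t + (300 * size_E + 40) * (m - k') \<le> 1 + (300 * size_E + 40) * (m - 0)) (set_reg ''k'' 0 s)"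
  proof (rule wp_While[where I=search_inv])
    show "search_inv 0 (set_reg ''k'' 0 s)" using s by (simp add: search_inv_def)
  next
    fix k s' assume "search_inv k s'" "holds (Less (Reg ''k'') (Reg ''m'')) s'"
    then show "wp W round (\<lambda>t s''. \<exists>k'. search_inv k' s'' \<and>
        1 + t + (300 * size_E + 40) * (m - k') \<le> (300 * size_E + 40) * (m - k)) s'"
      by (intro round_wp) (auto simp: search_inv_def graph_in_def)
  qed
  then have "wp W search (\<lambda>t s'. \<exists>k'. search_inv k' s' \<and>
      \<not> holds (Less (Reg ''k'') (Reg ''m'')) s' \<and> t \<le> (300 * size_E + 40) * m + 2) s"
    unfolding search_def by (simp add: wp_Seq wp_Copy) (erule wp_mono, force)
  then show ?thesis
  proof (rule wp_mono, elim exE conjE)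
    fix t s' k assume inv: "search_inv k s'" and "\<not> holds (Less (Reg ''k'') (Reg ''m'')) s'"
      and t: "t \<le> (300 * size_E + 40) * m + 2"
    then have k: "k = m" by (auto simp: search_inv_def graph_in_def)
    have "\<not> homogeneous_pair_of_cliques {..<n} E A B" if "regs s' ''found'' = 0" for A B
    proof
      assume "homogeneous_pair_of_cliques {..<n} E A B"
      then obtain X u v where X: "pair_on n E X" "u \<in> X True" "v \<in> X True" "{u, v} \<in> E"
        by (rule homogeneous_pair_contains_edge)
      from cover[OF X(4)] obtain i where "i < m" "{u, v} = {fst (es ! i), snd (es ! i)}" by blast
      then have "i < k" "fst (es ! i) \<in> X True" "snd (es ! i) \<in> X True"
        using X k by (auto simp: doubleton_eq_iff)
      then show False using inv that X(1) by (auto simp: search_inv_def)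
    qed
    then show "t \<le> (300 * size_E + 40) * m + 2 \<and> correct_answer {..<n} E s'"
      using t inv by (auto simp: correct_answer_def out_found_def search_inv_def)
  qed
qed

end

section \<open>Correctness of the adjacency tables\<close>

text \<open>An edge enters the tables as two directed halves, each of which changes the row of one
  vertex only.\<close>

definition halves :: "(nat \<times> nat) list \<Rightarrow> (nat \<times> nat) list" where
  "halves es = concat (map (\<lambda>(u, v). [(u, v), (v, u)]) es)"

definition nbrs :: "(nat \<times> nat) list \<Rightarrow> nat \<Rightarrow> nat list" where
  "nbrs hs v = map snd (filter (\<lambda>h. fst h = v) hs)"

lemma halves_append: "halves (xs @ [(u, v)]) = (halves xs @ [(u, v)]) @ [(v, u)]"
  by (simp add: halves_def)

lemma set_halves: "set (halves es) = {(u, v). (u, v) \<in> set es \<or> (v, u) \<in> set es}"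
  by (auto simp: halves_def)

lemma length_halves: "length (halves es) = 2 * length es"
  by (induction es) (auto simp: halves_def)

lemma nbrs_append: "nbrs (hs @ [(x, y)]) v = nbrs hs v @ (if v = x then [y] else [])"
  by (auto simp: nbrs_def)

lemma set_nbrs: "set (nbrs hs v) = {w. (v, w) \<in> set hs}"
  by (force simp: nbrs_def)

lemma distinct_nbrs: "distinct hs \<Longrightarrow> distinct (nbrs hs v)"
  by (auto simp: nbrs_def distinct_map inj_on_def prod_eq_iff)

lemma sum_length_nbrs: "(\<And>h. h \<in> set hs \<Longrightarrow> fst h < n) \<Longrightarrow> (\<Sum>v<n. length (nbrs hs v)) = length hs"
proof (induction hs)
  case (Cons h hs)
  have "(\<Sum>v<n. length (nbrs (h # hs) v)) = (\<Sum>v<n. length (nbrs hs v) + (if v = fst h then 1 else 0))"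
    by (rule sum.cong) (auto simp: nbrs_def)
  then show ?case using Cons by (simp add: sum.distrib)
qed (simp add: nbrs_def)

text \<open>\<open>S\<close> may exceed the sources of \<open>hs\<close>, since a row is reserved
  before its first entry is written. Row 0 is shared by all vertices without a row of their own, and
  \<open>c\<close> is the start of the last row in use.\<close>

definition tables :: "nat \<Rightarrow> (nat \<times> nat) list \<Rightarrow> nat set \<Rightarrow> nat \<Rightarrow> (nat \<Rightarrow> nat) \<Rightarrow> (nat \<Rightarrow> nat) \<Rightarrow>
    (nat \<Rightarrow> nat) \<Rightarrow> (nat \<Rightarrow> nat) \<Rightarrow> bool" where
  "tables n hs S c off deg nbr adj \<longleftrightarrow>
     finite S \<and> fst ` set hs \<subseteq> S \<and> c = n * card S \<and>
     (\<forall>v. (off v = 0 \<longleftrightarrow> v \<notin> S) \<and> n dvd off v \<and> off v \<le> c \<and> deg v = length (nbrs hs v) \<and>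
        (\<forall>i<length (nbrs hs v). nbr (off v + i) = nbrs hs v ! i) \<and>
        (\<forall>w<n. adj (off v + w) = (if (v, w) \<in> set hs then 1 else 0))) \<and>
     inj_on off S \<and> (\<forall>a\<ge>c + n. adj a = 0)"

lemma tables_Nil: "tables n [] {} 0 (\<lambda>_. 0) (\<lambda>_. 0) (\<lambda>_. 0) (\<lambda>_. 0)"
  by (simp add: tables_def nbrs_def)

lemma tablesD:
  assumes "tables n hs S c off deg nbr adj"
  shows "finite S" "(v, w) \<in> set hs \<Longrightarrow> v \<in> S" "c = n * card S" "off v = 0 \<longleftrightarrow> v \<notin> S" "n dvd off v"
    "off v \<le> c" "deg v = length (nbrs hs v)" "i < length (nbrs hs v) \<Longrightarrow> nbr (off v + i) = nbrs hs v ! i"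
    "w < n \<Longrightarrow> adj (off v + w) = (if (v, w) \<in> set hs then 1 else 0)" "inj_on off S"
    "c + n \<le> a \<Longrightarrow> adj a = 0"
  using assms unfolding tables_def by (force, force, blast+)

text \<open>No row in use starts beyond \<open>c\<close>, so the matrix cells from
  \<open>c + n\<close> on are still zero, which is already correct for a vertex without half
  edges.\<close>

lemma tables_reserve:
  assumes t: "tables n hs S c off deg nbr adj" and x: "x \<notin> S" and n: "0 < n"
  shows "tables n hs (insert x S) (c + n) (off(x := c + n)) deg nbr adj"
proof -
  note D = tablesD[OF t]
  have no: "(x, w) \<notin> set hs" for w using D(2) x by blast
  then have no_nbrs: "nbrs hs x = []" using set_nbrs[of hs x] by simp
  have new: "off v \<noteq> c + n" "c + n \<noteq> off v" for v using D(6)[of v] n by linarith+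
  have "inj_on (off(x := c + n)) (insert x S)"
  proof (rule inj_onI)
    fix a b assume "a \<in> insert x S" "b \<in> insert x S" "(off(x := c + n)) a = (off(x := c + n)) b"
    then show "a = b" using new inj_onD[OF D(10), of a b] by (cases "a = x"; cases "b = x") simp_all
  qed
  moreover have "c + n = n * card (insert x S)" using D(1,3) x by simp
  moreover have "((off(x := c + n)) v = 0 \<longleftrightarrow> v \<notin> insert x S) \<and> n dvd (off(x := c + n)) v \<and>
      (off(x := c + n)) v \<le> c + n \<and> deg v = length (nbrs hs v) \<and>
      (\<forall>i<length (nbrs hs v). nbr ((off(x := c + n)) v + i) = nbrs hs v ! i) \<and>
      (\<forall>w<n. adj ((off(x := c + n)) v + w) = (if (v, w) \<in> set hs then 1 else 0))" for v
  proof (cases "v = x")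
    case True
    have "n dvd c" using D(3) by simp
    then show ?thesis using True n D(7)[of x] D(11) no no_nbrs by simp
  next
    case False
    then show ?thesis using D(4,5,6,7)[of v] D(8,9)[of _ v] by (simp add: trans_le_add1)
  qed
  moreover have "fst ` set hs \<subseteq> insert x S" using D(2) by force
  ultimately show ?thesis using D(1,11) unfolding tables_def by simp
qed

text \<open>Rows start at multiples of \<open>n\<close>, so the remainder of an address modulo
  \<open>n\<close> recovers the column.\<close>

lemma tables_offset:
  assumes "tables n hs S c off deg nbr adj" "off v + a = off w + b" "a < n" "b < n"
  shows "off v = off w" "a = b"
proof -
  have "(off v + a) mod n = a" "(off w + b) mod n = b"
    using tablesD(5)[OF assms(1)] assms(3,4) by (metis add.commute mod_add_self2 mod_less mod_mult_self2
        dvd_def)+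
  then show "a = b" using assms(2) by simp
  then show "off v = off w" using assms(2) by simp
qed

lemma length_nbrs_le:
  assumes "distinct hs" "\<And>h. h \<in> set hs \<Longrightarrow> snd h < n"
  shows "length (nbrs hs v) \<le> n"
proof -
  have "card (set (nbrs hs v)) \<le> card {..<n}"
    using assms(2) unfolding set_nbrs by (intro card_mono) force+
  then show ?thesis using distinct_nbrs[OF assms(1), of v] by (simp add: distinct_card)
qed

text \<open>Offsets are injective on \<open>S\<close> and nonzero there, so a write affects the row
  of \<open>x\<close> only. Distinct half edges keep the old degree below \<open>n\<close>, so the
  neighbour list does not run into the next row.\<close>

lemma tables_insert:
  assumes t: "tables n hs S c off deg nbr adj" and x: "x \<in> S"
    and hs: "distinct (hs @ [(x, y)])" "\<And>h. h \<in> set (hs @ [(x, y)]) \<Longrightarrow> snd h < n"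
  shows "tables n (hs @ [(x, y)]) S c off (deg(x := deg x + 1)) (nbr(off x + deg x := y)) (adj(off x + y
      := 1))"
proof -
  note D = tablesD[OF t]
  have off: "off v = off x \<Longrightarrow> v = x" for v
    using D(4)[of v] D(4)[of x] D(10) x by (metis inj_onD)
  have len: "length (nbrs (hs @ [(x, y)]) v) \<le> n" for v
    using hs by (rule length_nbrs_le)
  have y: "y < n" using hs(2)[of "(x, y)"] by simp
  have dx: "deg x = length (nbrs hs x)" "deg x < n" using D(7)[of x] len[of x] by (auto simp: nbrs_append)
  have "(nbr(off x + deg x := y)) (off v + i) = nbrs (hs @ [(x, y)]) v ! i"
    if i: "i < length (nbrs (hs @ [(x, y)]) v)" for v i
  proof (cases "v = x \<and> i = deg x")
    case True
    then show ?thesis by (simp add: nbrs_append dx)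
  next
    case False
    then have i': "i < length (nbrs hs v)" using i dx by (auto simp: nbrs_append split: if_splits)
    have "i < n" using i len[of v] by simp
    then have "off v + i \<noteq> off x + deg x"
      using tables_offset[OF t, of v i x "deg x"] off[of v] False dx by blast
    then show ?thesis using i' D(8)[OF i'] by (simp add: nbrs_append nth_append)
  qed
  moreover have "(adj(off x + y := 1)) (off v + w) = (if (v, w) \<in> set (hs @ [(x, y)]) then 1 else 0)"
      if "w < n" for v w
    using tables_offset[OF t, of v w x y] off[of v] that y D(9)[OF that, of v] by auto
  moreover have "(adj(off x + y := 1)) a = 0" if "c + n \<le> a" for a
    using that y D(6)[of x] D(11)[OF that] by simp
  moreover have "(deg(x := deg x + 1)) v = length (nbrs (hs @ [(x, y)]) v)" for v
    using D(7) by (simp add: nbrs_append)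
  moreover have "fst ` set (hs @ [(x, y)]) \<subseteq> S" using D(2) x by force
  ultimately show ?thesis using D(1,3,4,5,6,10) unfolding tables_def by simp
qed

text \<open>The number of edges coded, the number of distinct list entries and the length form an
  increasing chain whose ends agree, so all three are equal.\<close>

lemma edge_list_distinct:
  assumes "edge_list_of E es"
  shows "distinct es" "inj_on (\<lambda>(u, v). {u, v}) (set es)"
proof -
  let ?f = "\<lambda>(u, v). {u, v}"
  have "card (?f ` set es) = length es" using assms by (simp add: edge_list_of_def)
  moreover have "card (?f ` set es) \<le> card (set es)" by (rule card_image_le) simp
  moreover have "card (set es) \<le> length es" by (rule card_length)
  ultimately have "card (set es) = length es" "card (?f ` set es) = card (set es)" by auto
  then show "distinct es" "inj_on ?f (set es)" by (auto simp: card_distinct intro: eq_card_imp_inj_on)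
qed

lemma distinct_halves:
  assumes graph: "simple_graph V E" and es: "edge_list_of E es" and k: "k \<le> length es"
  shows "distinct (halves (take k es))"
  using k
proof (induction k)
  case (Suc k)
  obtain u v where uv: "es ! k = (u, v)" by (cases "es ! k")
  have mem: "(u, v) \<in> set es" using uv Suc.prems by (metis nth_mem Suc_le_eq)
  then have "{u, v} \<in> E" using es by (force simp: edge_list_of_def)
  then have ne: "u \<noteq> v" using graph by (auto simp: simple_graph_def)
  have d: "distinct (take k es @ [(u, v)])"
    using edge_list_distinct(1)[OF es] Suc.prems uv
    by (metis Suc_le_eq distinct_take take_Suc_conv_app_nth)
  \<comment> \<open>A reversed copy would code the same edge a second time, against injectivity of
    the coding and \<open>u \<noteq> v\<close>.\<close>
  have "(v, u) \<notin> set (take k es)"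
    using edge_list_distinct(2)[OF es] mem ne set_take_subset[of k es]
    by (force simp: inj_on_def insert_commute)
  then show ?case using Suc uv ne d
    by (simp add: take_Suc_conv_app_nth halves_append set_halves)
qed (simp add: halves_def)

text \<open>The flag and the marks are carried along because the search starts from their zero
  values.\<close>

definition build_inv :: "nat \<Rightarrow> (nat \<times> nat) list \<Rightarrow> (nat \<times> nat) list \<Rightarrow> state \<Rightarrow> bool" where
  "build_inv n es hs s \<longleftrightarrow>
     tables n hs (fst ` set hs) (regs s ''c'') (arrs s ''off'') (arrs s ''deg'') (arrs s ''nbr'') (arrs
         s ''adj'') \<and>
     regs s ''n'' = n \<and> regs s ''m'' = length es \<and> regs s ''found'' = 0 \<and>
     (\<forall>i<length es. arrs s ''src'' i = fst (es ! i) \<and> arrs s ''dst'' i = snd (es ! i)) \<and>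
     (\<forall>\<sigma> y. arrs s (mark_name \<sigma>) y = 0)"

lemma insert_half_wp:
  assumes inv: "build_inv n es hs s" and regs: "regs s xr = x" "regs s yr = y"
    and r: "xr \<in> {''u'', ''v''}" "yr \<in> {''u'', ''v''}"
    and hs: "distinct (hs @ [(x, y)])" "\<And>h. h \<in> set (hs @ [(x, y)]) \<Longrightarrow> fst h < n \<and> snd h < n"
    and len: "length hs < 2 * length es" and W: "n * (2 * length es) + n \<le> W"
  shows "wp W (insert_half xr yr) (\<lambda>t s'. t \<le> 12 \<and> build_inv n es (hs @ [(x, y)]) s' \<and>
    (\<forall>r\<in>{''u'', ''v'', ''k''}. regs s' r = regs s r)) s"
proof -
  let ?S = "fst ` set hs"
  let ?c = "regs s ''c''" and ?off = "arrs s ''off''" and ?deg = "arrs s ''deg''"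
    and ?nbr = "arrs s ''nbr''" and ?adj = "arrs s ''adj''"
  have t: "tables n hs ?S ?c ?off ?deg ?nbr ?adj" using inv by (simp add: build_inv_def)
  have xy: "x < n" "y < n" using hs(2)[of "(x, y)"] by auto
  define o' where "o' = (if ?off x = 0 then ?c + n else ?off x)"
  define c' where "c' = (if ?off x = 0 then ?c + n else ?c)"
  have seen: "?off x = 0 \<longleftrightarrow> x \<notin> ?S" using tablesD(4)[OF t] .
  have t1: "tables n hs (insert x ?S) c' (?off(x := o')) ?deg ?nbr ?adj"
  proof (cases "?off x = 0")
    case True
    then show ?thesis using tables_reserve[OF t, of x] seen xy by (simp add: o'_def c'_def)
  next
    case False
    then have "insert x ?S = ?S" "?off(x := o') = ?off" using seen by (auto simp: o'_def)
    then show ?thesis using t False by (simp add: c'_def)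
  qed
  have t2: "tables n (hs @ [(x, y)]) (insert x ?S) c' (?off(x := o')) (?deg(x := ?deg x + 1))
      (?nbr(o' + ?deg x := y)) (?adj(o' + y := 1))"
    using tables_insert[OF t1 _ hs(1)] hs(2) by simp
  have S': "insert x ?S = fst ` set (hs @ [(x, y)])" by simp
  \<comment> \<open>Every reserved row stems from a half edge, so there are at most
    \<open>2 * length es\<close> of them, which bounds the last offset.\<close>
  have "card (insert x ?S) \<le> length (hs @ [(x, y)])"
    unfolding S' by (rule order_trans[OF card_image_le card_length]) simp
  then have "c' \<le> n * (2 * length es)" using tablesD(3)[OF t1] len by simp
  moreover have o'c: "o' \<le> c'" using tablesD(6)[OF t1, of x] by simp
  moreover have deg: "?deg x + 1 \<le> n"
    using length_nbrs_le[OF hs(1), of n x] hs(2) tablesD(7)[OF t, of x] by (simp add: nbrs_append)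
  ultimately have bounds: "c' \<le> W" "o' \<le> W" "o' + y \<le> W" "o' + ?deg x \<le> W" "?deg x + 1 \<le> W" "y \<le> W" "1 \<le> W"
    using W xy by auto
  have r': "xr \<noteq> ''o''" "xr \<noteq> ''c''" "xr \<noteq> ''z''" "xr \<noteq> ''p''" "xr \<noteq> ''d''"
    "yr \<noteq> ''o''" "yr \<noteq> ''c''" "yr \<noteq> ''z''" "yr \<noteq> ''p''" "yr \<noteq> ''d''" using r by auto
  have n: "regs s ''n'' = n" using inv by (simp add: build_inv_def)
  show ?thesis
  proof (cases "?off x = 0")
    case True
    then have "o' = ?c + n" "c' = ?c + n" by (auto simp: o'_def c'_def)
    then show ?thesis using True bounds regs r' n t2 inv
      by (simp add: insert_half_def wp_simps) (simp add: build_inv_def)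
  next
    case False
    then have "o' = ?off x" "c' = ?c" by (auto simp: o'_def c'_def)
    then show ?thesis using False bounds regs r' n t2 inv
      by (simp add: insert_half_def wp_simps) (simp add: build_inv_def fun_upd_idem)
  qed
qed

lemma build_inv_set_reg [simp]:
  "r \<in> {''u'', ''v'', ''k''} \<Longrightarrow> build_inv n es hs (set_reg r x s) \<longleftrightarrow> build_inv n es hs s"
  by (auto simp: build_inv_def)

lemma build_body_wp:
  assumes graph: "simple_graph {..<n} E" and es: "edge_list_of E es"
    and W: "n * (2 * length es) + n \<le> W" "length es \<le> W"
    and k: "k < length es" and s: "build_inv n es (halves (take k es)) s" "regs s ''k'' = k"
  shows "wp W build_body (\<lambda>t s'. t \<le> 27 \<and> build_inv n es (halves (take (Suc k) es)) s' \<and>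
      regs s' ''k'' = Suc k) s"
proof -
  obtain u v where uv: "es ! k = (u, v)" by (cases "es ! k")
  have E: "{a, b} \<in> E" if "(a, b) \<in> set es" for a b using es that by (force simp: edge_list_of_def)
  have n: "a < n \<and> b < n" if "(a, b) \<in> set (halves es)" for a b
  proof -
    have "{a, b} \<in> E" using that E[of a b] E[of b a] by (auto simp: set_halves insert_commute)
    then have "{a, b} \<subseteq> {..<n}" using graph unfolding simple_graph_def by blast
    then show ?thesis by simp
  qed
  have split: "halves (take (Suc k) es) = (halves (take k es) @ [(u, v)]) @ [(v, u)]"
    using k uv by (simp add: take_Suc_conv_app_nth halves_append)
  have dist: "distinct ((halves (take k es) @ [(u, v)]) @ [(v, u)])"
    using distinct_halves[OF graph es, of "Suc k"] k unfolding split by simp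
  have sub: "set ((halves (take k es) @ [(u, v)]) @ [(v, u)]) \<subseteq> set (halves es)"
    unfolding split[symmetric] using set_take_subset[of "Suc k" es] by (auto simp: set_halves)
  have lt: "fst h < n \<and> snd h < n" if "h \<in> set ((halves (take k es) @ [(u, v)]) @ [(v, u)])" for h
    using n[of "fst h" "snd h"] that sub by auto
  have uvn: "u < n" "v < n" using lt[of "(u, v)"] by auto
  have len: "length (halves (take k es)) = 2 * k" using k by (simp add: length_halves)
  have nW: "n \<le> W" using W(1) by simp
  have arr: "arrs s ''src'' k = u" "arrs s ''dst'' k = v" using s(1) k uv by (auto simp: build_inv_def)
  let ?s1 = "set_reg ''v'' v (set_reg ''u'' u s)"
  have 1: "wp W (insert_half ''u'' ''v'') (\<lambda>t s'. t \<le> 12 \<and> build_inv n es (halves (take k es) @ [(u, v)]) s' \<and>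
      (\<forall>r\<in>{''u'', ''v'', ''k''}. regs s' r = regs ?s1 r)) ?s1"
    by (rule insert_half_wp) (use s dist lt k W len in auto)
  have 2: "wp W (insert_half ''v'' ''u'') (\<lambda>t s'. t \<le> 12 \<and> build_inv n es ((halves (take k es) @ [(u,
      v)]) @ [(v, u)]) s' \<and>
      (\<forall>r\<in>{''u'', ''v'', ''k''}. regs s' r = regs s2 r)) s2"
    if "build_inv n es (halves (take k es) @ [(u, v)]) s2" "regs s2 ''u'' = u" "regs s2 ''v'' = v" for s2
    by (rule insert_half_wp) (use that dist lt k W len in auto)
  have 3: "wp W (insert_half ''u'' ''v'';; insert_half ''v'' ''u'';; Add ''k'' (Reg ''k'') (Const 1))
      (\<lambda>t s'. t \<le> 25 \<and> build_inv n es (halves (take (Suc k) es)) s' \<and> regs s' ''k'' = Suc k) ?s1"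
    unfolding wp_Seq
  proof (rule wp_mono[OF 1], elim conjE)
    fix t :: nat and s2 assume t: "t \<le> 12" and s2: "build_inv n es (halves (take k es) @ [(u, v)]) s2"
      "\<forall>r\<in>{''u'', ''v'', ''k''}. regs s2 r = regs ?s1 r"
    then have r: "regs s2 ''u'' = u" "regs s2 ''v'' = v" "regs s2 ''k'' = k" using s(2) by auto
    show "wp W (insert_half ''v'' ''u'') (\<lambda>t'. wp W (Add ''k'' (Reg ''k'') (Const 1)) (\<lambda>t'' s'.
        t + (t' + t'') \<le> 25 \<and> build_inv n es (halves (take (Suc k) es)) s' \<and> regs s' ''k'' = Suc k)) s2"
      unfolding split by (rule wp_mono[OF 2[OF s2(1) r(1,2)]]) (use t r k W in \<open>simp add: wp_Add\<close>)
  qed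
  show ?thesis unfolding build_body_def wp_Seq[of W "Load _ _ _"] wp_Load
    using arr uvn nW s(2) 3 by simp
qed

lemma build_wp:
  assumes graph: "simple_graph {..<n} E" and es: "edge_list_of E es"
    and W: "n * (2 * length es) + n \<le> W" "length es \<le> W"
  shows "wp W build (\<lambda>t s'. t \<le> 30 * length es + 2 \<and> build_inv n es (halves es) s') (input n es)"
proof -
  let ?I = "\<lambda>k s. k \<le> length es \<and> regs s ''k'' = k \<and> build_inv n es (halves (take k es)) s"
  have m: "regs s ''m'' = length es" if "?I k s" for k s using that by (simp add: build_inv_def)
  have "wp W (While (Less (Reg ''k'') (Reg ''m'')) build_body)
      (\<lambda>t s'. \<exists>k. ?I k s' \<and> \<not> holds (Less (Reg ''k'') (Reg ''m'')) s' \<and>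
        t + 30 * (length es - k) \<le> 1 + 30 * (length es - 0)) (set_reg ''k'' 0 (input n es))"
  proof (rule wp_While[where I = ?I])
    show "?I 0 (set_reg ''k'' 0 (input n es))"
      using tables_Nil[of n] by (simp add: build_inv_def input_def halves_def)
  next
    fix k s assume I: "?I k s" and "holds (Less (Reg ''k'') (Reg ''m'')) s"
    then have k: "k < length es" using m[OF I] by simp
    show "wp W build_body (\<lambda>t s'. \<exists>k'. ?I k' s' \<and> 1 + t + 30 * (length es - k') \<le> 30 * (length es - k)) s"
      by (rule wp_mono[OF build_body_wp[OF graph es W k]]) (use I k in \<open>auto intro!: exI[of _ "Suc k"]\<close>)
  qed
  then have "wp W (While (Less (Reg ''k'') (Reg ''m'')) build_body)
      (\<lambda>t s'. Suc t \<le> 30 * length es + 2 \<and> build_inv n es (halves es) s') (set_reg ''k'' 0 (input n es))"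
  proof (rule wp_mono, elim exE)
    fix t s' k assume I: "?I k s' \<and> \<not> holds (Less (Reg ''k'') (Reg ''m'')) s' \<and>
      t + 30 * (length es - k) \<le> 1 + 30 * (length es - 0)"
    then have "k = length es" using m[of k s'] by simp
    then show "Suc t \<le> 30 * length es + 2 \<and> build_inv n es (halves es) s'" using I by simp
  qed
  then show ?thesis by (simp add: build_def wp_Seq wp_Copy)
qed

section \<open>Word size and total running time\<close>

text \<open>The square contains \<open>2 * (n * m)\<close> and \<open>4 * n\<close>, enough for
  \<open>2 * m\<close> rows after row 0. The factor 600 is \<open>300 * size_E\<close> per edge with
  \<open>size_E = 2 * m\<close>; the \<open>+ 1\<close> under the square absorbs the linear terms
  and the case \<open>m = 0\<close>.\<close>

lemma solve_wp:
  assumes graph: "simple_graph {..<n} E" and es: "edge_list_of E es"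
    and W: "W = (n + card E + 2)\<^sup>2"
  shows "wp W solve (\<lambda>t s. t \<le> 600 * (card E + 1)\<^sup>2 \<and> correct_answer {..<n} E s) (input n es)"
proof -
  define m where "m = card E"
  have m: "length es = m" using es by (simp add: edge_list_of_def m_def)
  have W': "W = n * n + m * m + 2 * (n * m) + 4 * n + 4 * m + 4"
    by (simp add: W m_def power2_eq_square algebra_simps)
  have bounds: "n * (2 * m) + n \<le> W" "m + 1 \<le> W" "n + 1 \<le> W" unfolding W' by (simp_all add: algebra_simps)
  show ?thesis
  proof (cases "n < 3")
    case True
    have "\<not> homogeneous_pair_of_cliques {..<n} E A B" for A B
        using homogeneous_pair_order[of n E A B] True by auto
    moreover have "1 \<le> (Suc (card E))\<^sup>2" by simp
    then have "Suc (Suc 0) \<le> 600 * (Suc (card E))\<^sup>2" by linarith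
    ultimately show ?thesis using True
      by (simp add: solve_def wp_simps input_def correct_answer_def out_found_def)
  next
    case False
    have cover: "\<exists>i<m. e = {fst (es ! i), snd (es ! i)}" if "e \<in> E" for e
    proof -
      have "e \<in> (\<lambda>(u, v). {u, v}) ` set es" using that es by (simp add: edge_list_of_def)
      then obtain a b where "(a, b) \<in> set es" "e = {a, b}" by auto
      then show ?thesis using m by (metis in_set_conv_nth fst_conv snd_conv)
    qed
    have search: "wp W search (\<lambda>t s'. t \<le> (600 * m + 40) * m + 2 \<and> correct_answer {..<n} E s') s"
      if s: "build_inv n es (halves es) s" for s
    proof -
      let ?N = "nbrs (halves es)"
      have t: "tables n (halves es) (fst ` set (halves es)) (regs s ''c'') (arrs s ''off'') (arrs s
          ''deg'') (arrs s ''nbr'') (arrs s ''adj'')"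
        using s by (simp add: build_inv_def)
      note D = tablesD[OF t]
      have half: "(u, v) \<in> set (halves es) \<longleftrightarrow> {u, v} \<in> E" for u v
      proof -
        have E: "E = (\<lambda>(u, v). {u, v}) ` set es" using es by (simp add: edge_list_of_def)
        show ?thesis unfolding E set_halves image_iff by (fastforce simp: doubleton_eq_iff)
      qed
      have lt: "u < n \<and> v < n" if "(u, v) \<in> set (halves es)" for u v
        using that graph unfolding half by (auto simp: simple_graph_def)
      have dist: "distinct (halves es)" using distinct_halves[OF graph es, of "length es"] by simp
      have "regs s ''c'' \<le> n * (2 * m)"
        unfolding D(3) by (intro mult_le_mono2 order_trans[OF card_image_le] order_trans[OF card_length])
          (simp_all add: length_halves m)
      then have off: "arrs s ''off'' v + n \<le> W" for v using D(6)[of v] bounds(1) by linarith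
      interpret adjacency_data W n m E es ?N "arrs s ''off''" "arrs s ''deg''" "arrs s ''nbr''" "arrs s
          ''adj''"
      proof
        show "set (?N v) = {w. adjacent E v w}" for v by (simp add: set_nbrs half adjacent_def)
        show "length (?N v) \<le> n" for v by (rule length_nbrs_le[OF dist]) (use lt in force)
        show "arrs s ''adj'' (arrs s ''off'' v + w) = (if adjacent E v w then 1 else 0)" if "w < n" for v w
          using D(9)[OF that, of v] by (simp add: half adjacent_def)
        show "{fst (es ! i), snd (es ! i)} \<in> E" if "i < m" for i
          using half[of "fst (es ! i)" "snd (es ! i)"] nth_mem[of i es] that m
          by (simp add: set_halves case_prod_beta)
      qed (use graph D off bounds False in auto)
      have "size_E = 2 * m"
        unfolding size_E_def using sum_length_nbrs[of "halves es" n] lt by (force simp: length_halves m)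
      moreover have "graph_in s" using s m by (simp add: graph_in_def build_inv_def)
      ultimately show ?thesis using search_wp[of s] s cover by (simp add: build_inv_def)
    qed
    have "wp W (build;; search) (\<lambda>t s. Suc t \<le> 600 * (m + 1)\<^sup>2 \<and> correct_answer {..<n} E s) (input n es)"
      unfolding wp_Seq
    proof (rule wp_mono[OF build_wp[OF graph es]])
      fix t s' assume b: "t \<le> 30 * length es + 2 \<and> build_inv n es (halves es) s'"
      show "wp W search (\<lambda>t' s. Suc (t + t') \<le> 600 * (m + 1)\<^sup>2 \<and> correct_answer {..<n} E s) s'"
        by (rule wp_mono[OF search]) (use b in \<open>auto simp: m power2_eq_square algebra_simps\<close>)
    qed (use bounds m in auto)
    then show ?thesis using False by (simp add: solve_def wp_If input_def m_def)
  qed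
qed

theorem theorem8p4:
  "\<exists>(p :: prog) (T :: nat \<Rightarrow> nat).
     (\<lambda>m. real (T m)) \<in> O(\<lambda>m. (real m)\<^sup>2) \<and> finds_homogeneous_pair_in_time p T"
proof (intro exI conjI)
  show "(\<lambda>m. real (600 * (m + 1)\<^sup>2)) \<in> O(\<lambda>m. (real m)\<^sup>2)"
  \<comment> \<open>For \<open>m \<ge> 1\<close> the square of \<open>m + 1\<close> is at most four
    times that of \<open>m\<close>, and 4 times 600 is 2400.\<close>
  proof (rule bigoI[where c = 2400])
    have "real (600 * (m + 1)\<^sup>2) \<le> 2400 * (real m)\<^sup>2" if "1 \<le> m" for m :: nat
    proof -
      have "(real m + 1)\<^sup>2 \<le> (2 * real m)\<^sup>2" using that by (intro power_mono) auto
      then show ?thesis by (simp add: power_mult_distrib add.commute)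
    qed
    then show "\<forall>\<^sub>F m in sequentially. norm (real (600 * (m + 1)\<^sup>2)) \<le> 2400 * norm ((real m)\<^sup>2)"
      by (intro eventually_sequentiallyI[of 1]) simp
  qed
  show "finds_homogeneous_pair_in_time solve (\<lambda>m. 600 * (m + 1)\<^sup>2)"
    unfolding finds_homogeneous_pair_in_time_def
    using solve_wp unfolding wp_def by (intro exI[of _ 2]) blast
qed

end
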